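(* Let $(A,\alpha)$ be a Lebesgue space with continuous measure. Then the group $\mathrm{Gms}(A)$, embedded in $\mathrm{Pol}(A,A)$ by $g\mapsto\mathfrak I[g]$, is dense in $\mathrm{Pol}(A,A)$.
   Context: A Lebesgue space $(A,\alpha)$ is a space with a finite positive measure, $\alpha(A)>0$, isomorphic to a disjoint union of a finite (possibly empty) segment with Lebesgue measure and an at most countable collection of atoms; the measure is continuous if there are no atoms. $\mathbb R^\times$ is the multiplicative group of positive reals, with coordinate $t$. $\mathcal M^{\triangledown}$ is the set of positive measures $\mu$ on $\mathbb R^\times$ with $\int d\mu<\infty$ and $\int t\,d\mu(t)<\infty$. Convergence $\mu_j\to\mu$ in $\mathcal M^{\triangledown}$ means that $\mu_j\to\mu$ and $t\mu_j\to t\mu$ weakly (tested against bounded continuous functions on $\mathbb R^\times$). $\mathrm{Pol}(A,A)$ is the set of measures $\mathfrak P$ on $A\times A\times\mathbb R^\times$ such that the image of $\mathfrak P$ under the projection to the first factor $A$ is $\alpha$ and the image of $t\cdot\mathfrak P$ under the projection to the second factor $A$ is $\alpha$. For measurable $M,N\subset A$, $\mathfrak p[M\times N]\in\mathcal M^{\triangledown}$ is the image of the restriction of $\mathfrak P$ to $M\times N\times\mathbb R^\times$ under the projection to $\mathbb R^\times$. A sequence $\mathfrak P^{(j)}$ converges to $\mathfrak P$ in $\mathrm{Pol}(A,A)$ if $\mathfrak p^{(j)}[M\times N]\to\mathfrak p[M\times N]$ in $\mathcal M^{\triangledown}$ for all measurable $M,N\subset A$; density is understood with respect to this convergence (every element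 is the limit of a sequence from the subset). $\mathrm{Gms}(A)$ is the group of (a.s. defined) measurable bijections $g:A\to A$ leaving $\alpha$ quasi-invariant (images and preimages of null sets are null); the Radon–Nikodym derivative $g'$ is defined by $\alpha(gM)=\int_M g'(a)\,d\alpha(a)$ for all measurable $M\subset A$. $\mathfrak I[g]\in\mathrm{Pol}(A,A)$ is the image of $\alpha$ under the map $a\mapsto(a,g(a),g'(a))$. *)

theory Defs
  imports "HOL-Analysis.Analysis"
begin

section \<open>Lebesgue spaces\<close>

definition disjoint_sum :: "'a measure \<Rightarrow> 'b measure \<Rightarrow> ('a + 'b) measure" where
  "disjoint_sum M N = measure_of (space M <+> space N)
     {S. S \<subseteq> space M <+> space N \<and> Inl -` S \<in> sets M \<and> Inr -` S \<in> sets N}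
     (\<lambda>S. emeasure M (Inl -` S) + emeasure N (Inr -` S))"

lemma sigma_algebra_disjoint_sum:
  "sigma_algebra (space M <+> space N)
     {S. S \<subseteq> space M <+> space N \<and> Inl -` S \<in> sets M \<and> Inr -` S \<in> sets N}"
proof -
  have *: "Inl -` (space M <+> space N - S) = space M - Inl -` S"
    "Inr -` (space M <+> space N - S) = space N - Inr -` S" for S :: "('a + 'b) set"
    by auto
  show ?thesis
    unfolding sigma_algebra_iff2
    by (auto simp: * vimage_UN intro!: sets.countable_UN')
qed

lemma space_disjoint_sum [simp]: "space (disjoint_sum M N) = space M <+> space N"
  unfolding disjoint_sum_def by (rule space_measure_of) auto

lemma sets_disjoint_sum:
  "sets (disjoint_sum M N) =
     {S. S \<subseteq> space M <+> space N \<and> Inl -` S \<in> sets M \<and> Inr -` S \<in> sets N}"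
  unfolding disjoint_sum_def
  by (rule sigma_algebra.sets_measure_of_eq[OF sigma_algebra_disjoint_sum])

lemma emeasure_disjoint_sum:
  assumes "S \<in> sets (disjoint_sum M N)"
  shows "emeasure (disjoint_sum M N) S = emeasure M (Inl -` S) + emeasure N (Inr -` S)"
proof (rule emeasure_measure_of[OF disjoint_sum_def])
  show "positive (sets (disjoint_sum M N)) (\<lambda>S. emeasure M (Inl -` S) + emeasure N (Inr -` S))"
    by (simp add: positive_def)
  show "countably_additive (sets (disjoint_sum M N))
          (\<lambda>S. emeasure M (Inl -` S) + emeasure N (Inr -` S))"
  proof (rule countably_additiveI)
    fix A :: "nat \<Rightarrow> ('a + 'b) set"
    assume A: "range A \<subseteq> sets (disjoint_sum M N)" "disjoint_family A"
    then have "range (\<lambda>i. Inl -` A i) \<subseteq> sets M" "range (\<lambda>i. Inr -` A i) \<subseteq> sets N"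
      by (auto simp: sets_disjoint_sum)
    moreover have "disjoint_family (\<lambda>i. Inl -` A i)" "disjoint_family (\<lambda>i. Inr -` A i)"
      using A(2) unfolding disjoint_family_on_def by blast+
    ultimately have
      "(\<Sum>i. emeasure M (Inl -` A i)) = emeasure M (\<Union>i. Inl -` A i)"
      "(\<Sum>i. emeasure N (Inr -` A i)) = emeasure N (\<Union>i. Inr -` A i)"
      by (intro suminf_emeasure; simp)+
    then show "(\<Sum>i. emeasure M (Inl -` A i) + emeasure N (Inr -` A i)) =
        emeasure M (Inl -` (\<Union>i. A i)) + emeasure N (Inr -` (\<Union>i. A i))"
      by (simp add: suminf_add[symmetric] vimage_UN)
  qed
qed (use assms in \<open>auto simp: sets_disjoint_sum\<close>)

text \<open>Isomorphism of measure spaces up to null sets: a bijection between sets of full measure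
  that is bimeasurable and measure preserving.\<close>

definition iso_mod0 :: "'a measure \<Rightarrow> 'b measure \<Rightarrow> bool" where
  "iso_mod0 M N \<longleftrightarrow> (\<exists>f. \<exists>Z \<in> null_sets M. \<exists>Z' \<in> null_sets N.
     bij_betw f (space M - Z) (space N - Z') \<and>
     (\<forall>S. S \<subseteq> space M - Z \<longrightarrow> (S \<in> sets M \<longleftrightarrow> f ` S \<in> sets N)) \<and>
     (\<forall>S \<in> sets M. S \<subseteq> space M - Z \<longrightarrow> emeasure N (f ` S) = emeasure M S))"

text \<open>A Lebesgue space may come with its complete sigma-algebra or with a smaller, Borel-type one.
  Both are admitted: notions defined up to null sets always refer to the completion, which
  is the given measure itself if that is already complete.

  The set \<open>J\<close> indexes the atoms and \<open>w\<close> gives their masses. The segment is empty (modulo null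
  sets) for \<open>L = 0\<close>.\<close>

definition lebesgue_space :: "'a measure \<Rightarrow> bool" where
  "lebesgue_space M \<longleftrightarrow> finite_measure M \<and> 0 < emeasure M (space M) \<and>
     (\<exists>(L::real) (J::nat set) (w::nat \<Rightarrow> real). 0 \<le> L \<and> (\<forall>n\<in>J. 0 < w n) \<and>
        iso_mod0 (completion M)
          (disjoint_sum (lebesgue_on {0..L}) (point_measure J (\<lambda>n. ennreal (w n)))))"

definition atoms :: "'a measure \<Rightarrow> 'a set" where
  "atoms M = {a \<in> space M. {a} \<in> sets (completion M) \<and> 0 < emeasure (completion M) {a}}"

definition continuous_measure :: "'a measure \<Rightarrow> bool" where
  "continuous_measure M \<longleftrightarrow> atoms M = {}"

section \<open>Measures on the multiplicative group of positive reals\<close>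

abbreviation pos_reals :: "real measure" where
  "pos_reals \<equiv> restrict_space borel {0<..}"

definition M_nabla :: "real measure set" where
  "M_nabla = {\<mu>. sets \<mu> = sets pos_reals \<and>
     emeasure \<mu> (space \<mu>) < \<infinity> \<and> (\<integral>\<^sup>+ t. ennreal t \<partial>\<mu>) < \<infinity>}"

definition weak_conv_pos :: "(nat \<Rightarrow> real measure) \<Rightarrow> real measure \<Rightarrow> bool" where
  "weak_conv_pos \<mu>s \<mu> \<longleftrightarrow>
     (\<forall>f :: real \<Rightarrow> real. continuous_on {0<..} f \<and> bounded (f ` {0<..}) \<longrightarrow>
        (\<lambda>j. integral\<^sup>L (\<mu>s j) f) \<longlonglongrightarrow> integral\<^sup>L \<mu> f)"

definition M_nabla_conv :: "(nat \<Rightarrow> real measure) \<Rightarrow> real measure \<Rightarrow> bool" where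
  "M_nabla_conv \<mu>s \<mu> \<longleftrightarrow> (\<forall>j. \<mu>s j \<in> M_nabla) \<and> \<mu> \<in> M_nabla \<and>
     weak_conv_pos \<mu>s \<mu> \<and>
     weak_conv_pos (\<lambda>j. density (\<mu>s j) ennreal) (density \<mu> ennreal)"

section \<open>Polymorphisms\<close>

abbreviation pol_space :: "'a measure \<Rightarrow> ('a \<times> 'a \<times> real) measure" where
  "pol_space M \<equiv> M \<Otimes>\<^sub>M M \<Otimes>\<^sub>M pos_reals"

definition pol :: "'a measure \<Rightarrow> ('a \<times> 'a \<times> real) measure set" where
  "pol M = {P. sets P = sets (pol_space M) \<and>
     distr P M (\<lambda>(a, b, t). a) = M \<and>
     distr (density P (\<lambda>(a, b, t). ennreal t)) M (\<lambda>(a, b, t). b) = M}"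

definition pol_block :: "('a \<times> 'a \<times> real) measure \<Rightarrow> 'a set \<Rightarrow> 'a set \<Rightarrow> real measure" where
  "pol_block P S T =
     distr (restrict_space P (S \<times> T \<times> {0<..})) pos_reals (\<lambda>(a, b, t). t)"

definition pol_conv ::
  "'a measure \<Rightarrow> (nat \<Rightarrow> ('a \<times> 'a \<times> real) measure) \<Rightarrow> ('a \<times> 'a \<times> real) measure \<Rightarrow> bool" where
  "pol_conv M Ps P \<longleftrightarrow>
     (\<forall>S \<in> sets M. \<forall>T \<in> sets M. M_nabla_conv (\<lambda>j. pol_block (Ps j) S T) (pol_block P S T))"

definition dense_in_pol :: "'a measure \<Rightarrow> ('a \<times> 'a \<times> real) measure set \<Rightarrow> bool" where
  "dense_in_pol M D \<longleftrightarrow> D \<subseteq> pol M \<and>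
     (\<forall>P \<in> pol M. \<exists>Ps. (\<forall>j. Ps j \<in> D) \<and> pol_conv M Ps P)"

section \<open>Transformations with quasi-invariant measure\<close>

text \<open>An almost surely defined transformation is represented by a total function. The
  representative is required to send every null set to a null set, including the null set on
  which injectivity fails, so that \<open>g ` S\<close> is determined up to null sets by the transformation.
  Such a representative always exists: take the identity on the exceptional null set.\<close>

definition gms :: "'a measure \<Rightarrow> ('a \<Rightarrow> 'a) set" where
  "gms M = {g. g \<in> measurable (completion M) (completion M) \<and>
     (\<exists>Z \<in> null_sets (completion M). \<exists>Z' \<in> null_sets (completion M).
        bij_betw g (space M - Z) (space M - Z')) \<and>
     (\<forall>S \<in> sets (completion M). g ` S \<in> sets (completion M)) \<and>
     (\<forall>S \<in> null_sets (completion M). g ` S \<in> null_sets (completion M) \<and>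
        g -` S \<inter> space M \<in> null_sets (completion M))}"

text \<open>The Radon-Nikodym derivative is determined almost everywhere; as it is almost everywhere
  positive, a version with values in the positive reals is chosen.\<close>

definition gms_deriv :: "'a measure \<Rightarrow> ('a \<Rightarrow> 'a) \<Rightarrow> 'a \<Rightarrow> real" where
  "gms_deriv M g = (SOME d. d \<in> borel_measurable (completion M) \<and> (\<forall>a. 0 < d a) \<and>
     (\<forall>S \<in> sets (completion M).
        emeasure (completion M) (g ` S) = (\<integral>\<^sup>+ a \<in> S. ennreal (d a) \<partial>completion M)))"

definition pol_of_gms :: "'a measure \<Rightarrow> ('a \<Rightarrow> 'a) \<Rightarrow> ('a \<times> 'a \<times> real) measure" where
  "pol_of_gms M g = distr (completion M) (pol_space M) (\<lambda>a. (a, g a, gms_deriv M g a))"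

end

theory Submission
  imports Defs "HOL-Probability.Weak_Convergence"
begin

text \<open>
  Let \<open>P\<close> be a polymorphism. In a continuous Lebesgue space, identified with an interval \<open>[0, L)\<close>,
  consider the partition into \<open>n\<close> intervals \<open>A\<^sub>i\<close> of equal length, and let \<open>p\<^sub>i\<^sub>j\<close> be the block of \<open>P\<close> on
  \<open>A\<^sub>i \<times> A\<^sub>j\<close>. The marginal conditions on \<open>P\<close> say that the masses of the \<open>p\<^sub>i\<^sub>j\<close> sum over \<open>j\<close> to \<open>\<alpha>(A\<^sub>i)\<close> and
  that the means \<open>\<integral> t dp\<^sub>i\<^sub>j\<close> sum over \<open>i\<close> to \<open>\<alpha>(A\<^sub>j)\<close>. Hence \<open>A\<^sub>i\<close> splits into intervals with the masses
  of the \<open>p\<^sub>i\<^sub>j\<close> as lengths, and \<open>A\<^sub>j\<close> splits into intervals with the means as lengths. The increasing map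
  from the piece of \<open>A\<^sub>i\<close> to the piece of \<open>A\<^sub>j\<close> whose derivative is the quantile function of \<open>p\<^sub>i\<^sub>j\<close> has a
  derivative with law \<open>p\<^sub>i\<^sub>j\<close>, and it is onto because the integral of the derivative is the mean. Together
  these maps form a transformation \<open>g\<^sub>n\<close> whose blocks on the \<open>A\<^sub>i \<times> A\<^sub>j\<close>, and on unions of such sets,
  are exactly those of \<open>P\<close> (\<open>interval_map_with_blocks\<close>, \<open>gms_with_prescribed_blocks\<close>).

  It remains to pass to blocks on arbitrary measurable sets \<open>S\<close> and \<open>T\<close>, which are approximated in
  measure by unions of the \<open>A\<^sub>i\<close> (\<open>approx_by_blocks\<close>). The approximation error has to be small for all
  \<open>g\<^sub>n\<close> at once. A small set in the first factor has small \<open>P\<close>-measure and a small set in the second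
  factor has small \<open>t P\<close>-measure, by the marginal conditions; the other two combinations require that
  very small and very large values of \<open>t\<close> contribute little (\<open>block_integral_perturbation\<close>). This is
  uniform, because the block on the whole space is among those that agree: \<open>g\<^sub>n\<close> gives to \<open>t\<close> the same
  law as \<open>P\<close> does (\<open>pol_conv_by_block_agreement\<close>).
\<close>

section \<open>Increasing maps with a prescribed law of the derivative\<close>

lemma sets_pos_reals: "E \<in> sets pos_reals \<longleftrightarrow> E \<in> sets borel \<and> E \<subseteq> {0<..}"
  by (auto simp: sets_restrict_space_iff)

lemma atMost_Int_greaterThan_empty: "{..a} \<inter> {a<..} = ({}::real set)"
  by auto

text \<open>Every nonzero finite measure on the positive reals, of total mass \<open>b - a\<close>, is the law of a Borel function
on an interval of length \<open>b - a\<close>, namely of its quantile function rescaled to that interval. The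
value at null sets of exceptional points is adjusted to make the function positive everywhere,
because it will serve as a derivative.\<close>

lemma quantile_function:
  fixes p :: "real measure"
  assumes ab: "a < b" and sp: "sets p = sets pos_reals" and mass: "emeasure p (space p) = ennreal (b - a)"
  obtains d :: "real \<Rightarrow> real" where "d \<in> borel_measurable borel" "\<And>x. 0 < d x"
    "\<And>E. E \<in> sets borel \<Longrightarrow> E \<subseteq> {0<..} \<Longrightarrow> emeasure lborel {x\<in>{a..<b}. d x \<in> E} = emeasure p E"
proof -
  define c where "c = 1 / (b - a)"
  have c: "c > 0" "c * (b - a) = 1" using ab by (auto simp: c_def)
  have spp: "space p = {0<..}" using sets_eq_imp_space_eq[OF sp] by (simp add: space_restrict_space)
  have idm: "(\<lambda>x. x) \<in> measurable (scale_measure (ennreal c) p) borel"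
    by (subst measurable_cong_sets[of _ pos_reals _ borel]) (auto simp: sp intro: measurable_restrict_space1)
  define q where "q = distr (scale_measure (ennreal c) p) borel (\<lambda>x. x)"
  have q: "emeasure q E = ennreal c * emeasure p (E \<inter> {0<..})" if "E \<in> sets borel" for E
    using that by (simp add: q_def emeasure_distr[OF idm] space_scale_measure spp)
  have "prob_space q"
    using c(2) c(1) ab mass by (intro prob_spaceI) (simp add: q q_def[THEN arg_cong[where f=space]] spp ennreal_mult[symmetric])
  then interpret q: cdf_distribution q
    unfolding cdf_distribution_def real_distribution_def real_distribution_axioms_def by (simp add: q_def)
  define J where "J y = (if y \<in> {0<..<1} then q.I y else 0)" for y :: real
  have J[measurable]: "J \<in> borel_measurable borel"
    unfolding J_def[abs_def] using q.measurable_CI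
    by (subst measurable_restrict_space_iff[symmetric]) auto
  have Jq: "emeasure lborel {y\<in>{0<..<1}. J y \<in> E} = emeasure q E" if E: "E \<in> sets borel" for E
  proof -
    have "emeasure q E = emeasure (distr (restrict_space lborel {0<..<1::real}) borel q.I) E"
      by (simp add: q.distr_I_eq_M)
    also have "\<dots> = emeasure (restrict_space lborel {0<..<1::real}) (q.I -` E \<inter> {0<..<1})"
      using q.measurable_CI E by (subst emeasure_distr) (auto simp: space_restrict_space)
    also have "q.I -` E \<inter> {0<..<1} = {y\<in>{0<..<1}. J y \<in> E}"
      by (auto simp: J_def)
    also have "emeasure (restrict_space lborel {0<..<1::real}) \<dots> = emeasure lborel \<dots>"
      by (subst emeasure_restrict_space) auto
    finally show ?thesis by simp
  qed
  \<comment> \<open>The quantile function is positive almost everywhere; the value 1 elsewhere is arbitrary.\<close>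
  define d0 where "d0 y = (if J y > 0 then J y else 1)" for y
  have d0[measurable]: "d0 \<in> borel_measurable borel" unfolding d0_def[abs_def] by measurable
  have "emeasure lborel {y\<in>{0<..<1}. J y \<in> {..0}} = 0"
    by (subst Jq) (auto simp: q atMost_Int_greaterThan_empty)
  then have "AE y in lborel. \<not> (y \<in> {0<..<1} \<and> J y \<in> {..0})"
    by (subst AE_iff_measurable[OF _ refl]) (auto simp: conj_commute conj_left_commute)
  then have AEp: "AE y in lborel. y \<in> {0<..<1} \<longrightarrow> J y > 0" by eventually_elim auto
  have d0q: "emeasure lborel {y\<in>{0..<1}. d0 y \<in> E} = emeasure q E" if E[measurable]: "E \<in> sets borel" for E
  proof -
    have "emeasure lborel {y\<in>{0..<1}. d0 y \<in> E} = emeasure lborel {y\<in>{0<..<1}. J y \<in> E}"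
    proof (rule emeasure_eq_AE)
      show "AE x in lborel. (x \<in> {y \<in> {0..<1}. d0 y \<in> E}) = (x \<in> {y \<in> {0<..<1}. J y \<in> E})"
        using AEp AE_lborel_singleton[of "0::real"] by eventually_elim (auto simp: d0_def)
    qed measurable
    then show ?thesis by (simp only: Jq[OF E])
  qed
  show ?thesis
  proof (rule that[of "\<lambda>x. d0 ((x - a) / (b - a))"])
    fix E :: "real set" assume E[measurable]: "E \<in> sets borel" and Ep: "E \<subseteq> {0<..}"
    have "emeasure lborel {x\<in>{a..<b}. d0 ((x - a) / (b - a)) \<in> E}
        = emeasure (density (distr lborel borel (\<lambda>x. a + (b - a) * x)) (\<lambda>_. ennreal \<bar>b - a\<bar>))
           {x\<in>{a..<b}. d0 ((x - a) / (b - a)) \<in> E}"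
      using ab by (subst lborel_real_affine[of "b - a" a]) auto
    also have "\<dots> = ennreal (b - a) * emeasure lborel ((\<lambda>x. a + (b - a) * x) -` {x\<in>{a..<b}. d0 ((x - a) / (b - a)) \<in> E})"
      using ab by (subst emeasure_density_const) (auto simp: emeasure_distr)
    also have "(\<lambda>x. a + (b - a) * x) -` {x\<in>{a..<b}. d0 ((x - a) / (b - a)) \<in> E} = {y\<in>{0..<1}. d0 y \<in> E}"
    proof -
      have "a + (b - a) * x < b \<longleftrightarrow> x < 1" for x
        using ab mult_less_cancel_left_pos[of "b - a" x 1] by (auto simp: algebra_simps)
      moreover have "0 \<le> (b - a) * x \<longleftrightarrow> 0 \<le> x" for x
        using ab by (simp add: zero_le_mult_iff)
      ultimately show ?thesis using ab by auto
    qed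
    also have "ennreal (b - a) * emeasure lborel \<dots> = ennreal (b - a) * (ennreal c * emeasure p E)"
      using Ep by (simp only: d0q[OF E] q[OF E] Int_absorb2)
    also have "\<dots> = emeasure p E"
      using c ab by (simp add: mult.assoc[symmetric] ennreal_mult[symmetric] mult.commute)
    finally show "emeasure lborel {x\<in>{a..<b}. d0 ((x - a) / (b - a)) \<in> E} = emeasure p E" .
  qed (auto simp: d0_def)
qed

text \<open>The map is the primitive of \<open>d\<close>, that is, up to the constant \<open>u\<close> the distribution function of the
measure with density \<open>d\<close>. It is continuous because this measure has no atoms and strictly
increasing because \<open>d > 0\<close>. It sends the measure with density \<open>d\<close> to Lebesgue measure, as a
comparison of distribution functions shows; this is the formula for the measure of images, which
holds for a merely Borel \<open>d\<close> without any differentiability of the map at individual points.\<close>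

lemma increasing_map_with_density:
  fixes d :: "real \<Rightarrow> real"
  assumes ab: "a < b" and d[measurable]: "d \<in> borel_measurable borel" and pos: "\<And>x. 0 < d x"
    and int: "(\<integral>\<^sup>+x\<in>{a..<b}. ennreal (d x) \<partial>lborel) = ennreal (v - u)" and uv: "u \<le> v"
  obtains G :: "real \<Rightarrow> real" where "G \<in> borel_measurable borel" "bij_betw G {a..<b} {u..<v}"
    "\<And>E. E \<in> sets borel \<Longrightarrow> E \<subseteq> {a..<b} \<Longrightarrow> G ` E \<in> sets borel"
    "\<And>E. E \<in> sets borel \<Longrightarrow> E \<subseteq> {a..<b} \<Longrightarrow> emeasure lborel (G ` E) = (\<integral>\<^sup>+x\<in>E. ennreal (d x) \<partial>lborel)"
proof -
  define \<mu> where "\<mu> = density lborel (\<lambda>x. ennreal (d x) * indicator {a..<b} x)"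
  have sets\<mu>[simp, measurable_cong]: "sets \<mu> = sets borel" and space\<mu>[simp]: "space \<mu> = UNIV" by (auto simp: \<mu>_def)
  have em: "emeasure \<mu> E = (\<integral>\<^sup>+x\<in>E\<inter>{a..<b}. ennreal (d x) \<partial>lborel)" if [measurable]: "E \<in> sets borel" for E
    unfolding \<mu>_def by (subst emeasure_density) (auto intro!: nn_integral_cong split: split_indicator)
  have tot: "emeasure \<mu> UNIV = ennreal (v - u)" by (simp add: em int)
  interpret \<mu>: finite_borel_measure \<mu>
    by (intro finite_borel_measure.intro finite_measureI finite_borel_measure_axioms.intro) (simp_all add: tot)
  have null: "emeasure \<mu> E = 0 \<longleftrightarrow> emeasure lborel (E\<inter>{a..<b}) = 0" if [measurable]: "E \<in> sets borel" for E
  proof -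
    have "emeasure \<mu> E = 0 \<longleftrightarrow> (AE x in lborel. ennreal (d x) * indicator (E \<inter> {a..<b}) x = 0)"
      by (simp add: em nn_integral_0_iff_AE)
    also have "\<dots> \<longleftrightarrow> (AE x in lborel. x \<notin> E\<inter>{a..<b})"
      by (intro AE_cong) (use pos in \<open>auto split: split_indicator simp: less_le not_le\<close>)
    also have "\<dots> \<longleftrightarrow> emeasure lborel (E\<inter>{a..<b}) = 0"
      by (subst AE_iff_measurable[of "E\<inter>{a..<b}"]) auto
    finally show ?thesis .
  qed
  define G where "G x = u + cdf \<mu> x" for x
  have cont: "isCont G x" for x
  proof -
    have "emeasure \<mu> {x} = 0"
      using emeasure_mono[of "{x} \<inter> {a..<b}" "{x}" lborel] by (subst null) auto
    then have "isCont (cdf \<mu>) x"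
      by (simp add: \<mu>.isCont_cdf measure_def)
    then show ?thesis unfolding G_def by simp
  qed
  have mono: "G x \<le> G y" if "x \<le> y" for x y
    using \<mu>.cdf_nondecreasing[OF that] by (simp add: G_def)
  have strict: "G x < G y" if "a \<le> x" "x < y" "y \<le> b" for x y
  proof -
    have "emeasure lborel ({x<..y} \<inter> {a..<b}) \<ge> emeasure lborel {x<..<y}"
      using that by (intro emeasure_mono) auto
    then have "emeasure \<mu> {x<..y} \<noteq> 0" using that by (subst null) auto
    then have "measure \<mu> {x<..y} > 0"
      by (simp add: \<mu>.emeasure_eq_measure zero_less_measure_iff)
    then show ?thesis using \<mu>.cdf_diff_eq[OF that(2)] by (simp add: G_def)
  qed
  have Ga: "G a = u"
  proof -
    have "emeasure \<mu> {..a} = 0"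
    proof (subst null)
      have "{..a} \<inter> {a..<b} = {a}" using ab by auto
      then show "emeasure lborel ({..a} \<inter> {a..<b}) = 0" by simp
    qed simp
    then show ?thesis by (simp add: G_def cdf_def2 measure_def)
  qed
  have Gb: "G b = v"
  proof -
    have "{..b} \<inter> {a..<b} = {a..<b}" by auto
    then have "emeasure \<mu> {..b} = ennreal (v - u)"
      by (simp add: em int)
    then show ?thesis using uv by (simp add: G_def cdf_def2 measure_def)
  qed
  have Gm[measurable]: "G \<in> borel_measurable borel"
    by (intro borel_measurable_mono monoI mono)
  have inj: "inj_on G {a..<b}"
    by (intro linorder_inj_onI) (use strict in \<open>auto simp: less_le\<close>)
  have img: "G ` {a..<b} = {u..<v}"
  proof safe
    fix x assume "x \<in> {a..<b}"
    then show "G x \<in> {u..<v}" using mono[of a x] strict[of x b] Ga Gb by auto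
  next
    fix y assume y: "y \<in> {u..<v}"
    then obtain x where "a \<le> x" "x \<le> b" "G x = y"
      using IVT[of G a y b] ab Ga Gb cont by auto
    moreover have "x \<noteq> b" using \<open>G x = y\<close> y Gb by auto
    ultimately show "y \<in> G ` {a..<b}" by auto
  qed
  \<comment> \<open>The inverse is increasing, hence Borel, so images of Borel sets are Borel.\<close>
  define H where "H = the_inv_into {a..<b} G"
  have HG: "H (G x) = x" if "x \<in> {a..<b}" for x
    unfolding H_def using inj that by (rule the_inv_into_f_f)
  have Hin: "H y \<in> {a..<b}" "G (H y) = y" if "y \<in> {u..<v}" for y
    using that unfolding img[symmetric] by (auto simp: HG)
  have Hm: "H \<in> borel_measurable (restrict_space borel {u..<v})"
  proof (intro borel_measurable_mono_on_fnc mono_onI)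
    fix r s assume "r \<in> {u..<v}" "s \<in> {u..<v}" "r \<le> s"
    then show "H r \<le> H s"
      using strict[of "H s" "H r"] Hin(1)[of r] Hin(1)[of s] Hin(2)[of r] Hin(2)[of s] by force
  qed
  have GE: "G ` E = H -` E \<inter> {u..<v}" if "E \<subseteq> {a..<b}" for E
  proof -
    have "G x \<in> H -` E \<inter> {u..<v}" if "x \<in> E" for x
      using that \<open>E \<subseteq> {a..<b}\<close> HG[of x] unfolding img[symmetric] by (auto simp: subset_iff)
    moreover have "y \<in> G ` E" if "H y \<in> E" "y \<in> {u..<v}" for y
      using Hin(2)[OF that(2)] that(1) by (metis imageI)
    ultimately show ?thesis by blast
  qed
  have GEm: "G ` E \<in> sets borel" if "E \<in> sets borel" "E \<subseteq> {a..<b}" for E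
    unfolding GE[OF that(2)] using measurable_sets[OF Hm that(1)]
    by (simp add: space_restrict_space sets_restrict_space_iff)
  let ?\<nu> = "distr \<mu> borel G" and ?l = "density lborel (indicator {u..<v})"
  have eq: "?\<nu> = ?l"
  proof (rule cdf_unique')
    show "finite_borel_measure ?\<nu>"
      by (intro finite_borel_measure.intro \<mu>.finite_measure_distr finite_borel_measure_axioms.intro) simp_all
    show "finite_borel_measure ?l"
      by (intro finite_borel_measure.intro finite_measureI finite_borel_measure_axioms.intro)
         (use uv in \<open>simp_all add: emeasure_density\<close>)
    show "cdf ?\<nu> = cdf ?l"
    proof
      fix y
      have l: "emeasure ?l {..y} = emeasure lborel ({u..<v} \<inter> {..y})"
        by (subst emeasure_density) (auto simp: nn_integral_indicator[symmetric] indicator_inter_arith simp del: nn_integral_indicator)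
      have r: "emeasure ?\<nu> {..y} = emeasure \<mu> {x. G x \<le> y}"
        by (subst emeasure_distr) (auto simp: vimage_def)
      consider "y < u" | "u \<le> y" "y < v" | "v \<le> y" by linarith
      then have "emeasure ?\<nu> {..y} = emeasure ?l {..y}"
      proof cases
        case 1
        then have "{x. G x \<le> y} = {}" using \<mu>.cdf_nonneg by (auto simp: G_def not_le intro: less_le_trans)
        moreover have "{u..<v} \<inter> {..y} = {}" using 1 by auto
        ultimately show ?thesis unfolding r l by simp
      next
        case 2
        then obtain x where x: "x \<in> {a..<b}" "G x = y" using img by (metis atLeastLessThan_iff imageE)
        have "emeasure \<mu> {x. G x \<le> y} = emeasure \<mu> {..x}"
        proof (simp add: em, rule nn_integral_cong)
          fix z
          have "z \<in> {a..<b} \<Longrightarrow> G z \<le> y \<longleftrightarrow> z \<le> x"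
            using x mono[of z x] strict[of x z] by force
          then show "ennreal (d z) * indicator ({x. G x \<le> y} \<inter> {a..<b}) z = ennreal (d z) * indicator ({..x} \<inter> {a..<b}) z"
            by (auto split: split_indicator)
        qed
        also have "\<dots> = ennreal (y - u)" using x by (auto simp: \<mu>.emeasure_eq_measure G_def cdf_def2)
        also have "\<dots> = emeasure lborel {u..y}" using 2 by simp
        also have "{u..y} = {u..<v} \<inter> {..y}" using 2 by auto
        finally show ?thesis unfolding r l .
      next
        case 3
        have "G x \<le> v" for x
        proof -
          have "measure \<mu> UNIV = v - u" using tot uv by (simp add: measure_def)
          then show ?thesis using \<mu>.cdf_bounded[of x] by (simp add: G_def)
        qed
        then have "{x. G x \<le> y} = UNIV" using 3 by (auto intro: order_trans)
        moreover have "{u..<v} \<inter> {..y} = {u..<v}" using 3 by auto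
        ultimately show ?thesis unfolding r l using uv by (simp add: tot)
      qed
      then show "cdf ?\<nu> y = cdf ?l y" by (simp add: cdf_def2 measure_def)
    qed
  qed
  show ?thesis
  proof (rule that[of G])
    fix E assume E[measurable]: "E \<in> sets borel" and Eab: "E \<subseteq> {a..<b}"
    note [measurable] = GEm[OF E Eab]
    have "emeasure lborel (G ` E) = emeasure ?l (G ` E)"
    proof -
      have "G ` E \<subseteq> {u..<v}" using Eab img by auto
      then have "emeasure lborel (G ` E) = emeasure lborel ({u..<v} \<inter> G ` E)"
        by (simp add: Int_absorb1)
      also have "\<dots> = emeasure ?l (G ` E)"
        by (subst emeasure_density) (auto simp: nn_integral_indicator[symmetric] indicator_inter_arith simp del: nn_integral_indicator)
      finally show ?thesis .
    qed
    also have "\<dots> = emeasure ?\<nu> (G ` E)" by (simp add: eq)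
    also have "\<dots> = emeasure \<mu> (G -` G ` E)" by (subst emeasure_distr) auto
    also have "\<dots> = (\<integral>\<^sup>+x\<in>E. ennreal (d x) \<partial>lborel)"
    proof -
      have [measurable]: "G -` G ` E \<in> sets borel" using measurable_sets[OF Gm GEm[OF E Eab]] by simp
      have "G -` G ` E \<inter> {a..<b} = E" using Eab inj by (auto dest: inj_onD)
      then show ?thesis by (simp add: em)
    qed
    finally show "emeasure lborel (G ` E) = (\<integral>\<^sup>+x\<in>E. ennreal (d x) \<partial>lborel)" .
  qed (use inj img GEm in \<open>auto simp: bij_betw_def\<close>)
qed

section \<open>Interval automorphisms with prescribed blocks\<close>

text \<open>One block of the construction. An interval of length equal to the total mass of \<open>p\<close> is mapped onto
an interval of length equal to the mean of \<open>p\<close>, with derivative distributed exactly as \<open>p\<close>: the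
derivative is the quantile function, and its integral is the mean. If the mass is zero then so is
the mean, and both intervals are empty.\<close>

lemma block_map:
  fixes p :: "real measure"
  assumes sp: "sets p = sets pos_reals" and mass: "emeasure p (space p) = ennreal (b - a)"
    and mean: "(\<integral>\<^sup>+t. ennreal t \<partial>p) = ennreal (v - u)" and ab: "a \<le> b" and uv: "u \<le> v"
  shows "\<exists>(G :: real \<Rightarrow> real) (d :: real \<Rightarrow> real). G \<in> borel_measurable borel \<and> d \<in> borel_measurable borel \<and> (\<forall>x. 0 < d x) \<and>
    bij_betw G {a..<b} {u..<v} \<and>
    (\<forall>E\<in>sets borel. E \<subseteq> {a..<b} \<longrightarrow> G ` E \<in> sets borel \<and>
        emeasure lborel (G ` E) = (\<integral>\<^sup>+x\<in>E. ennreal (d x) \<partial>lborel)) \<and>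
    (\<forall>E\<in>sets borel. E \<subseteq> {0<..} \<longrightarrow> emeasure lborel {x\<in>{a..<b}. d x \<in> E} = emeasure p E)"
proof (cases "a < b")
  case True
  obtain d :: "real \<Rightarrow> real" where d[measurable]: "d \<in> borel_measurable borel" and pos: "\<And>x. 0 < d x"
    and law: "\<And>E. E \<in> sets borel \<Longrightarrow> E \<subseteq> {0<..} \<Longrightarrow> emeasure lborel {x\<in>{a..<b}. d x \<in> E} = emeasure p E"
    using quantile_function[OF True sp mass] by metis
  let ?R = "restrict_space lborel {a..<b}"
  have dR: "d \<in> measurable ?R pos_reals"
    using d pos by (intro measurable_restrict_space2 measurable_restrict_space1) auto
  have "distr ?R pos_reals d = p"
  proof (rule measure_eqI)
    fix E assume "E \<in> sets (distr ?R pos_reals d)"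
    then have E: "E \<in> sets borel" "E \<subseteq> {0<..}" by (auto simp: sets_pos_reals)
    have "emeasure (distr ?R pos_reals d) E = emeasure ?R {x\<in>{a..<b}. d x \<in> E}"
      using E by (subst emeasure_distr[OF dR])
        (auto simp: sets_pos_reals space_restrict_space intro!: arg_cong[where f="emeasure ?R"])
    also have "\<dots> = emeasure lborel {x\<in>{a..<b}. d x \<in> E}"
      by (subst emeasure_restrict_space) auto
    finally show "emeasure (distr ?R pos_reals d) E = emeasure p E" using law[OF E] by (simp only:)
  qed (simp add: sp)
  then have "ennreal (v - u) = (\<integral>\<^sup>+t. ennreal t \<partial>distr ?R pos_reals d)" by (simp add: mean)
  also have "\<dots> = (\<integral>\<^sup>+x. ennreal (d x) \<partial>?R)"
    by (subst nn_integral_distr[OF dR]) (auto intro: measurable_restrict_space1)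
  also have "\<dots> = (\<integral>\<^sup>+x\<in>{a..<b}. ennreal (d x) \<partial>lborel)"
    by (subst nn_integral_restrict_space) auto
  finally have int: "(\<integral>\<^sup>+x\<in>{a..<b}. ennreal (d x) \<partial>lborel) = ennreal (v - u)" by (rule sym)
  show ?thesis
  proof (rule increasing_map_with_density[OF True d pos int uv])
    fix G :: "real \<Rightarrow> real"
    assume "G \<in> borel_measurable borel" "bij_betw G {a..<b} {u..<v}"
      "\<And>E. E \<in> sets borel \<Longrightarrow> E \<subseteq> {a..<b} \<Longrightarrow> G ` E \<in> sets borel"
      "\<And>E. E \<in> sets borel \<Longrightarrow> E \<subseteq> {a..<b} \<Longrightarrow> emeasure lborel (G ` E) = (\<integral>\<^sup>+x\<in>E. ennreal (d x) \<partial>lborel)"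
    then show ?thesis using d pos law by (intro exI[of _ G] exI[of _ d]) simp
  qed
next
  case False
  then have "a = b" using ab by simp
  have p0: "emeasure p E = 0" for E
    using mass \<open>a = b\<close> emeasure_space[of p E] by simp
  have "(\<integral>\<^sup>+t. ennreal t \<partial>p) = 0"
  proof -
    have "AE t in p. False" using p0 by (intro AE_I[of _ _ "space p"]) auto
    then have "(\<integral>\<^sup>+t. ennreal t \<partial>p) = (\<integral>\<^sup>+t. 0 \<partial>p)" by (intro nn_integral_cong_AE) auto
    then show ?thesis by simp
  qed
  then have "u = v" using mean uv by simp
  show ?thesis
    using p0 \<open>a = b\<close> \<open>u = v\<close>
    by (intro exI[of _ "\<lambda>x. x"] exI[of _ "\<lambda>x. 1"]) (auto simp: bij_betw_def)
qed

lemma half_open_intervals_partition: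
  fixes s :: "nat \<Rightarrow> real"
  assumes "mono s"
  shows "(\<Union>k<n. {s k..<s (Suc k)}) = {s 0..<s n}" "disjoint_family (\<lambda>k. {s k..<s (Suc k)})"
proof -
  show "(\<Union>k<n. {s k..<s (Suc k)}) = {s 0..<s n}"
  proof (induction n)
    case (Suc n)
    have "s 0 \<le> s n" "s n \<le> s (Suc n)" using assms by (auto simp: mono_def)
    then show ?case using Suc by (auto simp: lessThan_Suc)
  qed simp
  show "disjoint_family (\<lambda>k. {s k..<s (Suc k)})"
  proof (unfold disjoint_family_on_def, intro ballI impI)
    fix k l :: nat assume "k \<noteq> l"
    then have "Suc k \<le> l \<or> Suc l \<le> k" by auto
    then have "s (Suc k) \<le> s l \<or> s (Suc l) \<le> s k" using assms by (auto simp: mono_def)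
    then show "{s k..<s (Suc k)} \<inter> {s l..<s (Suc l)} = {}" by auto
  qed
qed

definition cell :: "real \<Rightarrow> nat \<Rightarrow> real set" where
  "cell \<delta> i = {real i * \<delta>..<real (Suc i) * \<delta>}"

lemma cell_borel[measurable]: "cell \<delta> i \<in> sets borel"
  by (simp add: cell_def)

lemma cell_partition:
  assumes "0 \<le> \<delta>"
  shows "(\<Union>i<n. cell \<delta> i) = {0..<real n * \<delta>}" "disjoint_family (cell \<delta>)"
proof -
  have m: "mono (\<lambda>i. real i * \<delta>)" using assms by (auto simp: mono_def intro!: mult_right_mono)
  show "(\<Union>i<n. cell \<delta> i) = {0..<real n * \<delta>}" "disjoint_family (cell \<delta>)"
    using half_open_intervals_partition(1)[OF m, of n] half_open_intervals_partition(2)[OF m]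
    by (simp_all add: cell_def[abs_def])
qed

text \<open>The \<open>i\<close>-th cell is cut into consecutive intervals of lengths \<open>c i 0, c i 1, \<dots>\<close>.\<close>

definition subcell :: "real \<Rightarrow> (nat \<Rightarrow> nat \<Rightarrow> real) \<Rightarrow> nat \<Rightarrow> nat \<Rightarrow> real set" where
  "subcell \<delta> c i j = {real i * \<delta> + (\<Sum>l<j. c i l)..<real i * \<delta> + (\<Sum>l<Suc j. c i l)}"

lemma subcell_partition:
  assumes "\<And>i j. 0 \<le> c i j" "(\<Sum>l<n. c i l) = \<delta>"
  shows "(\<Union>j<n. subcell \<delta> c i j) = cell \<delta> i" "disjoint_family (subcell \<delta> c i)"
proof -
  have "mono (\<lambda>j. real i * \<delta> + (\<Sum>l<j. c i l))"
    using assms(1) by (auto intro!: monoI sum_mono2)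
  from half_open_intervals_partition(1)[OF this, of n] half_open_intervals_partition(2)[OF this]
  show "(\<Union>j<n. subcell \<delta> c i j) = cell \<delta> i" "disjoint_family (subcell \<delta> c i)"
    using assms(2) by (simp_all add: subcell_def[abs_def] cell_def algebra_simps)
qed

lemma subcell_disjoint:
  assumes c: "\<And>i j. 0 \<le> c i j" "\<And>i. i < n \<Longrightarrow> (\<Sum>l<n. c i l) = \<delta>"
    and "i < n" "j < n" "i' < n" "j' < n" and x: "x \<in> subcell \<delta> c i j" "x \<in> subcell \<delta> c i' j'"
  shows "i = i' \<and> j = j'"
proof -
  have \<delta>: "0 \<le> \<delta>" using c(2)[OF \<open>i < n\<close>] c(1) by (metis sum_nonneg)
  have "x \<in> cell \<delta> i" "x \<in> cell \<delta> i'"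
    using x assms(3-6) subcell_partition(1)[of c i n \<delta>] subcell_partition(1)[of c i' n \<delta>] c by blast+
  then have "i = i'" using cell_partition(2)[OF \<delta>] by (auto simp: disjoint_family_on_def)
  moreover have "j = j'"
    using x subcell_partition(2)[of c i n \<delta>] c \<open>i < n\<close> \<open>i = i'\<close> by (auto simp: disjoint_family_on_def)
  ultimately show ?thesis by simp
qed

text \<open>The matrix of measures \<open>p i j\<close> is realized exactly by one bijection of an interval. Row sums of the
masses let the \<open>i\<close>-th cell be cut into intervals \<open>A (i, j)\<close> of length equal to the mass of \<open>p i j\<close>;
column sums of the means let the \<open>j\<close>-th cell be cut into intervals \<open>B (i, j)\<close> of length equal to the
mean of \<open>p i j\<close>. Mapping each \<open>A (i, j)\<close> onto \<open>B (i, j)\<close> with derivative of law \<open>p i j\<close> gives a bijection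
because both families are partitions. Half-open intervals make it a bijection with no exceptional
null set.\<close>

lemma interval_map_with_blocks:
  fixes p :: "nat \<Rightarrow> nat \<Rightarrow> real measure" and c e :: "nat \<Rightarrow> nat \<Rightarrow> real"
  assumes sp: "\<And>i j. sets (p i j) = sets pos_reals"
    and mass: "\<And>i j. i < n \<Longrightarrow> j < n \<Longrightarrow> emeasure (p i j) (space (p i j)) = ennreal (c i j)"
    and mean: "\<And>i j. i < n \<Longrightarrow> j < n \<Longrightarrow> (\<integral>\<^sup>+t. ennreal t \<partial>p i j) = ennreal (e i j)"
    and c: "\<And>i j. 0 \<le> c i j" "\<And>i. i < n \<Longrightarrow> (\<Sum>j<n. c i j) = \<delta>"
    and e: "\<And>i j. 0 \<le> e i j" "\<And>j. j < n \<Longrightarrow> (\<Sum>i<n. e i j) = \<delta>"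
    and \<delta>: "0 \<le> \<delta>"
  obtains h D :: "real \<Rightarrow> real" where "h \<in> borel_measurable borel" "D \<in> borel_measurable borel"
    "\<And>x. 0 < D x" "bij_betw h {0..<real n * \<delta>} {0..<real n * \<delta>}"
    "\<And>E. E \<in> sets borel \<Longrightarrow> E \<subseteq> {0..<real n * \<delta>} \<Longrightarrow> h ` E \<in> sets borel"
    "\<And>E. E \<in> sets borel \<Longrightarrow> E \<subseteq> {0..<real n * \<delta>} \<Longrightarrow> emeasure lborel (h ` E) = (\<integral>\<^sup>+x\<in>E. ennreal (D x) \<partial>lborel)"
    "\<And>i j E. i < n \<Longrightarrow> j < n \<Longrightarrow> E \<in> sets borel \<Longrightarrow> E \<subseteq> {0<..} \<Longrightarrow>
       emeasure lborel {x\<in>cell \<delta> i. h x \<in> cell \<delta> j \<and> D x \<in> E} = emeasure (p i j) E"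
proof -
  define K where "K = {..<n} \<times> {..<n}"
  define A where "A k = subcell \<delta> c (fst k) (snd k)" for k
  define B where "B k = subcell \<delta> (\<lambda>j i. e i j) (snd k) (fst k)" for k
  have finK[simp]: "finite K" by (simp add: K_def)
  have "\<forall>k\<in>K. \<exists>(G :: real \<Rightarrow> real) (d :: real \<Rightarrow> real). G \<in> borel_measurable borel \<and> d \<in> borel_measurable borel \<and> (\<forall>x. 0 < d x) \<and>
    bij_betw G (A k) (B k) \<and>
    (\<forall>E\<in>sets borel. E \<subseteq> A k \<longrightarrow> G ` E \<in> sets borel \<and>
        emeasure lborel (G ` E) = (\<integral>\<^sup>+x\<in>E. ennreal (d x) \<partial>lborel)) \<and>
    (\<forall>E\<in>sets borel. E \<subseteq> {0<..} \<longrightarrow> emeasure lborel {x\<in>A k. d x \<in> E} = emeasure (p (fst k) (snd k)) E)"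
    unfolding A_def B_def subcell_def
    by (intro ballI block_map) (use mass mean c(1) e(1) sp in \<open>auto simp: K_def\<close>)
  from bchoice[OF this] obtain G where "\<forall>k\<in>K. \<exists>(d :: real \<Rightarrow> real). G k \<in> borel_measurable borel \<and> d \<in> borel_measurable borel \<and> (\<forall>x. 0 < d x) \<and>
    bij_betw (G k) (A k) (B k) \<and>
    (\<forall>E\<in>sets borel. E \<subseteq> A k \<longrightarrow> G k ` E \<in> sets borel \<and>
        emeasure lborel (G k ` E) = (\<integral>\<^sup>+x\<in>E. ennreal (d x) \<partial>lborel)) \<and>
    (\<forall>E\<in>sets borel. E \<subseteq> {0<..} \<longrightarrow> emeasure lborel {x\<in>A k. d x \<in> E} = emeasure (p (fst k) (snd k)) E)" ..
  from bchoice[OF this] obtain d where Gd: "\<forall>k\<in>K. G k \<in> borel_measurable borel \<and> d k \<in> borel_measurable borel \<and> (\<forall>x. 0 < d k x) \<and>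
    bij_betw (G k) (A k) (B k) \<and>
    (\<forall>E\<in>sets borel. E \<subseteq> A k \<longrightarrow> G k ` E \<in> sets borel \<and>
        emeasure lborel (G k ` E) = (\<integral>\<^sup>+x\<in>E. ennreal (d k x) \<partial>lborel)) \<and>
    (\<forall>E\<in>sets borel. E \<subseteq> {0<..} \<longrightarrow> emeasure lborel {x\<in>A k. d k x \<in> E} = emeasure (p (fst k) (snd k)) E)" ..
  have Gm: "G k \<in> borel_measurable borel" and dm: "d k \<in> borel_measurable borel"
    and dpos: "0 < d k x" and Gbij: "bij_betw (G k) (A k) (B k)"
    and Gim: "E \<in> sets borel \<Longrightarrow> E \<subseteq> A k \<Longrightarrow> G k ` E \<in> sets borel"
    and Gem: "E \<in> sets borel \<Longrightarrow> E \<subseteq> A k \<Longrightarrow>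
        emeasure lborel (G k ` E) = (\<integral>\<^sup>+x\<in>E. ennreal (d k x) \<partial>lborel)"
    and dlaw: "E \<in> sets borel \<Longrightarrow> E \<subseteq> {0<..} \<Longrightarrow>
        emeasure lborel {x\<in>A k. d k x \<in> E} = emeasure (p (fst k) (snd k)) E"
    if "k \<in> K" for k x E
    using bspec[OF Gd that] by simp_all
  have A[measurable]: "A k \<in> sets borel" and B[measurable]: "B k \<in> sets borel" for k
    by (auto simp: A_def B_def subcell_def)
  have uniqA: "k = l" if "k \<in> K" "l \<in> K" "x \<in> A k" "x \<in> A l" for k l x
    using that subcell_disjoint[of c n \<delta> "fst k" "snd k" "fst l" "snd l" x] c by (auto simp: K_def A_def)
  have uniqB: "k = l" if "k \<in> K" "l \<in> K" "x \<in> B k" "x \<in> B l" for k l x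
    using that subcell_disjoint[of "\<lambda>j i. e i j" n \<delta> "snd k" "fst k" "snd l" "fst l" x] e by (auto simp: K_def B_def)
  have cellA: "cell \<delta> i = (\<Union>j<n. A (i, j))" if "i < n" for i
    using subcell_partition(1)[of c i n \<delta>] c that by (simp add: A_def)
  have cellB: "cell \<delta> j = (\<Union>i<n. B (i, j))" if "j < n" for j
    using subcell_partition(1)[of "\<lambda>j i. e i j" j n \<delta>] e that by (simp add: B_def)
  have UA: "(\<Union>k\<in>K. A k) = {0..<real n * \<delta>}"
    unfolding cell_partition(1)[OF \<delta>, symmetric] by (auto simp: cellA K_def)
  have UB: "(\<Union>k\<in>K. B k) = {0..<real n * \<delta>}"
    unfolding cell_partition(1)[OF \<delta>, symmetric] by (auto simp: cellB K_def)
  have inA: "\<exists>k\<in>K. x \<in> A k" if "x \<in> {0..<real n * \<delta>}" for x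
    using that by (simp only: UA[symmetric] UN_iff)
  have Ain: "x \<in> {0..<real n * \<delta>}" if "k \<in> K" "x \<in> A k" for k x
    using that by (simp only: UA[symmetric] UN_iff) blast
  \<comment> \<open>Gluing by indicators makes Borel measurability immediate.\<close>
  define h where "h x = (\<Sum>k\<in>K. indicator (A k) x * G k x)" for x
  \<comment> \<open>The last summand keeps the derivative positive outside the interval.\<close>
  define D where "D x = (\<Sum>k\<in>K. indicator (A k) x * d k x) + indicator (- {0..<real n * \<delta>}) x" for x
  have hA: "h x = G k x" if "k \<in> K" "x \<in> A k" for k x
  proof -
    have "h x = (\<Sum>l\<in>K. if l = k then G k x else 0)"
      unfolding h_def using that uniqA by (intro sum.cong) (auto split: split_indicator)
    then show ?thesis using that by simp
  qed
  have DA: "D x = d k x" if "k \<in> K" "x \<in> A k" for k x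
  proof -
    have "(\<Sum>k\<in>K. indicator (A k) x * d k x) = (\<Sum>l\<in>K. if l = k then d k x else 0)"
      using that uniqA by (intro sum.cong) (auto split: split_indicator)
    moreover have "x \<in> {0..<real n * \<delta>}" using that by (rule Ain)
    ultimately show ?thesis using that by (simp add: D_def)
  qed
  have hB: "h x \<in> B k \<longleftrightarrow> x \<in> A k" if kK: "k \<in> K" and xL: "x \<in> {0..<real n * \<delta>}" for k x
  proof -
    obtain l where l: "l \<in> K" "x \<in> A l" using inA[OF xL] by blast
    then have hl: "h x \<in> B l" using Gbij[OF l(1)] hA[OF l] by (auto simp: bij_betw_def)
    show ?thesis
    proof
      assume "h x \<in> B k"
      then show "x \<in> A k" using uniqB[OF l(1) kK hl] l(2) by simp
    next
      assume "x \<in> A k"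
      then show "h x \<in> B k" using uniqA[OF l(1) kK l(2)] hl by simp
    qed
  qed
  have hm: "h \<in> borel_measurable borel"
    unfolding h_def[abs_def] using Gm by (intro borel_measurable_sum borel_measurable_times borel_measurable_indicator) auto
  have Dm[measurable]: "D \<in> borel_measurable borel"
    unfolding D_def[abs_def] using dm by (intro borel_measurable_sum borel_measurable_times borel_measurable_indicator borel_measurable_add) auto
  have split: "E = (\<Union>k\<in>K. E \<inter> A k)" if "E \<subseteq> {0..<real n * \<delta>}" for E
    using that inA by fast
  have hsplit: "h ` E = (\<Union>k\<in>K. G k ` (E \<inter> A k))" if "E \<subseteq> {0..<real n * \<delta>}" for E
  proof -
    have "h ` E = (\<Union>k\<in>K. h ` (E \<inter> A k))" using split[OF that] by blast
    also have "\<dots> = (\<Union>k\<in>K. G k ` (E \<inter> A k))" by (intro SUP_cong image_cong) (auto simp: hA)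
    finally show ?thesis .
  qed
  have hbij: "bij_betw h {0..<real n * \<delta>} {0..<real n * \<delta>}"
    unfolding bij_betw_def
  proof
    show "inj_on h {0..<real n * \<delta>}"
    proof (rule inj_onI)
      fix x y assume xy: "x \<in> {0..<real n * \<delta>}" "y \<in> {0..<real n * \<delta>}" "h x = h y"
      obtain k where k: "k \<in> K" "x \<in> A k" using inA[OF xy(1)] by blast
      then have "h y \<in> B k" using hB[OF k(1) xy(1)] xy(3) by simp
      then have "y \<in> A k" using hB[OF k(1) xy(2)] by simp
      then show "x = y" using hA[of k] k xy Gbij[OF k(1)] by (auto simp: bij_betw_def dest: inj_onD)
    qed
    have "h ` {0..<real n * \<delta>} = (\<Union>k\<in>K. G k ` A k)"
    proof -
      have "G k ` ({0..<real n * \<delta>} \<inter> A k) = G k ` A k" if "k \<in> K" for k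
      proof -
        have "{0..<real n * \<delta>} \<inter> A k = A k" using Ain[OF that] by blast
        then show ?thesis by simp
      qed
      then show ?thesis unfolding hsplit[OF order_refl] by (intro SUP_cong) auto
    qed
    also have "\<dots> = (\<Union>k\<in>K. B k)" using Gbij by (intro SUP_cong) (auto simp: bij_betw_def)
    finally show "h ` {0..<real n * \<delta>} = {0..<real n * \<delta>}" by (simp add: UB)
  qed
  show ?thesis
  proof (rule that[of h D])
    show "0 < D x" for x
    proof (cases "x \<in> {0..<real n * \<delta>}")
      case True
      then obtain k where "k \<in> K" "x \<in> A k" using inA[of x] by blast
      then show ?thesis using DA dpos by simp
    next
      case False
      have "(\<Sum>k\<in>K. indicator (A k) x * d k x) \<ge> 0" using dpos by (intro sum_nonneg mult_nonneg_nonneg) (auto intro: less_imp_le)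
      then show ?thesis using False by (simp add: D_def)
    qed
    fix E :: "real set" assume E[measurable]: "E \<in> sets borel" and EL: "E \<subseteq> {0..<real n * \<delta>}"
    show "h ` E \<in> sets borel"
      unfolding hsplit[OF EL] using Gim by (intro sets.finite_UN) auto
    have "emeasure lborel (h ` E) = (\<Sum>k\<in>K. emeasure lborel (G k ` (E \<inter> A k)))"
      unfolding hsplit[OF EL]
    proof (rule sum_emeasure[symmetric])
      show "disjoint_family_on (\<lambda>k. G k ` (E \<inter> A k)) K"
      proof (unfold disjoint_family_on_def, intro ballI impI)
        fix k l assume kl: "k \<in> K" "l \<in> K" "k \<noteq> l"
        have "G k ` (E \<inter> A k) \<subseteq> B k" "G l ` (E \<inter> A l) \<subseteq> B l"
          using Gbij[OF kl(1)] Gbij[OF kl(2)] by (auto simp: bij_betw_def)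
        then show "G k ` (E \<inter> A k) \<inter> G l ` (E \<inter> A l) = {}" using uniqB kl by blast
      qed
    qed (use Gim in auto)
    also have "\<dots> = (\<Sum>k\<in>K. (\<integral>\<^sup>+x\<in>E \<inter> A k. ennreal (D x) \<partial>lborel))"
    proof (rule sum.cong[OF refl])
      fix k assume k: "k \<in> K"
      have "emeasure lborel (G k ` (E \<inter> A k)) = (\<integral>\<^sup>+x\<in>E \<inter> A k. ennreal (d k x) \<partial>lborel)"
        using k by (intro Gem) auto
      also have "\<dots> = (\<integral>\<^sup>+x\<in>E \<inter> A k. ennreal (D x) \<partial>lborel)"
        using DA[OF k] by (intro nn_integral_cong) (auto split: split_indicator)
      finally show "emeasure lborel (G k ` (E \<inter> A k)) = (\<integral>\<^sup>+x\<in>E \<inter> A k. ennreal (D x) \<partial>lborel)" .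
    qed
    also have "\<dots> = (\<integral>\<^sup>+x. (\<Sum>k\<in>K. ennreal (D x) * indicator (E \<inter> A k) x) \<partial>lborel)"
      by (subst nn_integral_sum) auto
    also have "\<dots> = (\<integral>\<^sup>+x\<in>E. ennreal (D x) \<partial>lborel)"
    proof (rule nn_integral_cong)
      fix x
      have "(\<Sum>k\<in>K. indicator (E \<inter> A k) x) = (indicator E x :: ennreal)"
      proof (cases "x \<in> E")
        case True
        then obtain k where k: "k \<in> K" "x \<in> A k" using EL inA[of x] by blast
        have "(\<Sum>l\<in>K. indicator (E \<inter> A l) x) = (\<Sum>l\<in>K. if l = k then 1 else 0::ennreal)"
          using k uniqA True by (intro sum.cong) (auto split: split_indicator)
        then show ?thesis using k True by simp
      qed simp
      then show "(\<Sum>k\<in>K. ennreal (D x) * indicator (E \<inter> A k) x) = ennreal (D x) * indicator E x"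
        by (simp add: sum_distrib_left[symmetric])
    qed
    finally show "emeasure lborel (h ` E) = (\<integral>\<^sup>+x\<in>E. ennreal (D x) \<partial>lborel)" .
  next
    fix i j :: nat and E :: "real set" assume ij: "i < n" "j < n" and E: "E \<in> sets borel" "E \<subseteq> {0<..}"
    have K: "(i, j) \<in> K" using ij by (simp add: K_def)
    have "{x\<in>cell \<delta> i. h x \<in> cell \<delta> j \<and> D x \<in> E} = {x\<in>A (i, j). d (i, j) x \<in> E}"
    proof (safe)
      fix x assume x: "x \<in> cell \<delta> i" "h x \<in> cell \<delta> j" "D x \<in> E"
      obtain j' where j': "j' < n" "x \<in> A (i, j')" using x(1) cellA ij by auto
      obtain i' where i': "i' < n" "h x \<in> B (i', j)" using x(2) cellB ij by auto
      have L: "x \<in> {0..<real n * \<delta>}" using j' ij by (intro Ain[of "(i, j')"]) (auto simp: K_def)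
      then have "x \<in> A (i', j)" using hB i' ij by (auto simp: K_def)
      then have "(i, j') = (i', j)" using uniqA j' i' ij by (auto simp: K_def)
      then show "x \<in> A (i, j)" using j' by simp
      then show "d (i, j) x \<in> E" using x(3) DA[OF K] by simp
    next
      fix x assume x: "x \<in> A (i, j)" "d (i, j) x \<in> E"
      have L: "x \<in> {0..<real n * \<delta>}" using Ain[OF K] x by simp
      have "h x \<in> B (i, j)" using hB[OF K L] x by simp
      then show "h x \<in> cell \<delta> j" using ij by (auto simp: cellB)
      show "x \<in> cell \<delta> i" using ij x by (auto simp: cellA)
      show "D x \<in> E" using x DA[OF K] by simp
    qed
    then show "emeasure lborel {x\<in>cell \<delta> i. h x \<in> cell \<delta> j \<and> D x \<in> E} = emeasure (p i j) E"
      using dlaw[OF K E] by simp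
  qed (fact hm Dm hbij)+
qed

section \<open>Approximation of Lebesgue sets by cells\<close>

text \<open>Squeeze the set between a compact \<open>K\<close> and an open \<open>T\<close> of almost the same measure. Once the mesh is
smaller than the distance from \<open>K\<close> to the complement of \<open>T\<close>, the cells that meet \<open>K\<close> cover \<open>K\<close> and
stay inside \<open>T\<close>. This works for every fine mesh, so the partitions need not refine each other.\<close>

lemma lebesgue_set_approx_by_cells:
  assumes B: "B \<in> sets lebesgue" "B \<subseteq> {0..<L}" and L: "0 < L" and \<epsilon>: "0 < \<epsilon>"
  shows "\<forall>\<^sub>F n in sequentially. \<exists>J\<subseteq>{..<n}.
    emeasure lebesgue ((B - (\<Union>i\<in>J. cell (L / real n) i)) \<union> ((\<Union>i\<in>J. cell (L / real n) i) - B)) < ennreal \<epsilon>"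
proof -
  have half: "0 < \<epsilon> / 2" using \<epsilon> by simp
  obtain T where T: "open T" "B \<subseteq> T" "T - B \<in> lmeasurable" "emeasure lebesgue (T - B) < ennreal (\<epsilon> / 2)"
    using sets_lebesgue_outer_open[OF B(1) half] .
  obtain K where K: "closed K" "K \<subseteq> B" "B - K \<in> lmeasurable" "emeasure lebesgue (B - K) < ennreal (\<epsilon> / 2)"
    using sets_lebesgue_inner_closed[OF B(1) half] .
  have "bounded K" by (rule bounded_subset[OF bounded_closed_interval[of 0 L]]) (use K(2) B(2) in force)
  then have "compact K" using K(1) by (simp add: compact_eq_bounded_closed)
  moreover have "closed (- T)" "K \<inter> - T = {}" using T(1,2) K(2) by (simp_all add: closed_Compl, blast)
  ultimately obtain \<rho> where \<rho>: "0 < \<rho>" "\<And>x y. x \<in> K \<Longrightarrow> y \<in> - T \<Longrightarrow> \<rho> \<le> dist x y"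
    using separate_compact_closed[of K "- T"] by blast
  obtain n0 where n0: "L / \<rho> < real n0" using reals_Archimedean2 by blast
  show ?thesis
  proof (rule eventually_sequentiallyI[of "Suc n0"])
    fix n assume "Suc n0 \<le> n"
    then have n: "L / \<rho> < real n" "0 < n" using n0 by auto
    define \<delta> where "\<delta> = L / real n"
    have \<delta>: "0 \<le> \<delta>" "\<delta> < \<rho>" "real n * \<delta> = L" using n L \<rho>(1) by (auto simp: \<delta>_def field_simps)
    define J where "J = {i\<in>{..<n}. cell \<delta> i \<inter> K \<noteq> {}}"
    let ?U = "\<Union>i\<in>J. cell \<delta> i"
    have KU: "K \<subseteq> ?U"
    proof
      fix x assume x: "x \<in> K"
      then have "x \<in> (\<Union>i<n. cell \<delta> i)" using K(2) B(2) \<delta> by (auto simp: cell_partition(1))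
      then show "x \<in> ?U" using x by (auto simp: J_def)
    qed
    have UT: "?U \<subseteq> T"
    proof
      fix x assume "x \<in> ?U"
      then obtain i y where "x \<in> cell \<delta> i" "y \<in> cell \<delta> i" "y \<in> K" by (auto simp: J_def)
      then have "dist y x < \<delta>" by (auto simp: cell_def dist_real_def algebra_simps)
      then show "x \<in> T" using \<rho>(2)[OF \<open>y \<in> K\<close>, of x] \<delta> by fastforce
    qed
    have "emeasure lebesgue ((B - ?U) \<union> (?U - B)) \<le> emeasure lebesgue ((B - K) \<union> (T - B))"
      using KU UT T(3) K(3) by (intro emeasure_mono) (auto simp: fmeasurable_def)
    also have "\<dots> \<le> emeasure lebesgue (B - K) + emeasure lebesgue (T - B)"
      using T(3) K(3) by (intro emeasure_subadditive) (auto simp: fmeasurable_def)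
    also have "\<dots> < ennreal (\<epsilon> / 2) + ennreal (\<epsilon> / 2)"
      using T(4) K(4) by (intro add_strict_mono)
    also have "\<dots> = ennreal \<epsilon>" using \<epsilon> by (simp add: ennreal_plus[symmetric] del: ennreal_plus)
    finally show "\<exists>J\<subseteq>{..<n}. emeasure lebesgue ((B - (\<Union>i\<in>J. cell (L / real n) i)) \<union> ((\<Union>i\<in>J. cell (L / real n) i) - B)) < ennreal \<epsilon>"
      unfolding \<delta>_def[symmetric] by (intro exI[of _ J]) (auto simp: J_def)
  qed
qed

section \<open>Derivatives and graph measures of nonsingular transformations\<close>

lemma gmsD:
  assumes "g \<in> gms M"
  shows "g \<in> measurable (completion M) (completion M)"
    and "S \<in> sets (completion M) \<Longrightarrow> g ` S \<in> sets (completion M)"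
    and "S \<in> null_sets (completion M) \<Longrightarrow> g ` S \<in> null_sets (completion M)"
    and "S \<in> null_sets (completion M) \<Longrightarrow> g -` S \<inter> space M \<in> null_sets (completion M)"
  using assms by (auto simp: gms_def)

lemma gms_obtain_bij:
  assumes "g \<in> gms M"
  obtains Z Z' where "Z \<in> null_sets (completion M)" "Z' \<in> null_sets (completion M)"
    "bij_betw g (space M - Z) (space M - Z')"
  using assms by (auto simp: gms_def)

lemma emeasure_gms_image_Diff_null:
  assumes g: "g \<in> gms M" and S: "S \<in> sets (completion M)" and N: "N \<in> null_sets (completion M)"
  shows "emeasure (completion M) (g ` (S - N)) = emeasure (completion M) (g ` S)"
proof (rule emeasure_eq_AE)
  have "g ` (S \<inter> N) \<in> null_sets (completion M)"
    using N by (intro gmsD(3)[OF g]) (auto intro: null_sets_completion_subset)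
  then have "AE x in completion M. x \<notin> g ` (S \<inter> N)" by (rule AE_not_in)
  then show "AE x in completion M. (x \<in> g ` (S - N)) = (x \<in> g ` S)"
    by eventually_elim blast
qed (intro gmsD(2)[OF g] sets.Diff S null_setsD2[OF N])+

text \<open>The set function \<open>S \<mapsto> \<alpha>(g S)\<close> is the image of \<open>\<alpha>\<close> under an almost everywhere defined inverse of \<open>g\<close>, so
the Radon-Nikodym theorem applies: images of null sets are null. Preimages of null sets being null
makes the density positive almost everywhere. The existence shows that the choice operator in the
definition of the derivative picks a function with the defining property.\<close>

lemma gms_deriv_exists:
  assumes "finite_measure M" and g: "g \<in> gms M"
  shows "\<exists>d :: 'a \<Rightarrow> real. d \<in> borel_measurable (completion M) \<and> (\<forall>a. 0 < d a) \<and>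
     (\<forall>S \<in> sets (completion M).
        emeasure (completion M) (g ` S) = (\<integral>\<^sup>+ a \<in> S. ennreal (d a) \<partial>completion M))"
proof -
  let ?C = "completion M"
  interpret finite_measure M by fact
  interpret C: finite_measure ?C
    by (intro finite_measureI) (simp add: emeasure_eq_measure)
  obtain Z Z' where Z: "Z \<in> null_sets ?C" and Z': "Z' \<in> null_sets ?C"
    and bij: "bij_betw g (space M - Z) (space M - Z')"
    using gms_obtain_bij[OF g] .
  \<comment> \<open>An inverse of g off the null set Z', and the identity on Z'.\<close>
  define k where "k y = (if y \<in> space M - Z' then the_inv_into (space M - Z) g y else y)" for y
  have inj: "inj_on g (space M - Z)" and im: "g ` (space M - Z) = space M - Z'"
    using bij by (auto simp: bij_betw_def)
  have kg: "k (g x) = x" if "x \<in> space M - Z" for x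
  proof -
    have "g x \<in> space M - Z'" using that im by blast
    then show ?thesis using the_inv_into_f_f[OF inj that] by (simp add: k_def)
  qed
  have kvim: "k -` S \<inter> space M = g ` (S - Z) \<union> (S \<inter> Z')" if "S \<subseteq> space M" for S
  proof (intro set_eqI iffI)
    fix y assume y: "y \<in> k -` S \<inter> space M"
    show "y \<in> g ` (S - Z) \<union> (S \<inter> Z')"
    proof (cases "y \<in> Z'")
      case True then show ?thesis using y by (simp add: k_def)
    next
      case False
      then have "y \<in> g ` (space M - Z)" using y im by simp
      then obtain x where "x \<in> space M - Z" "y = g x" by blast
      then show ?thesis using y kg by auto
    qed
  next
    fix y assume y: "y \<in> g ` (S - Z) \<union> (S \<inter> Z')"
    then show "y \<in> k -` S \<inter> space M"
    proof
      assume "y \<in> g ` (S - Z)"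
      then obtain x where x: "x \<in> S" "x \<notin> Z" "y = g x" by blast
      then have "x \<in> space M - Z" using that by blast
      moreover from this have "y \<in> space M - Z'" using x im by blast
      ultimately show ?thesis using kg x by simp
    next
      assume "y \<in> S \<inter> Z'"
      then show ?thesis using that by (auto simp: k_def)
    qed
  qed
  have km: "k \<in> measurable ?C ?C"
  proof (rule measurableI)
    fix y assume "y \<in> space ?C"
    then show "k y \<in> space ?C" using kvim[OF order_refl] im by (auto simp: k_def the_inv_into_into[OF inj, of y "space M - Z"] intro: the_inv_into_into[OF inj _ Diff_subset, simplified])
  next
    fix S assume S: "S \<in> sets ?C"
    then have "S \<subseteq> space M" using sets.sets_into_space by fastforce
    then show "k -` S \<inter> space ?C \<in> sets ?C"
      using S Z Z' gmsD(2)[OF g, of "S - Z"] by (simp add: kvim null_setsD2 sets.Int sets.Un sets.Diff)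
  qed
  have k: "emeasure (distr ?C ?C k) S = emeasure ?C (g ` S)" if S: "S \<in> sets ?C" for S
  proof -
    have "S \<subseteq> space M" using S sets.sets_into_space by fastforce
    then have "emeasure (distr ?C ?C k) S = emeasure ?C (g ` (S - Z) \<union> (S \<inter> Z'))"
      using S by (simp add: emeasure_distr[OF km] kvim)
    also have "\<dots> = emeasure ?C (g ` (S - Z))"
      using S Z Z' gmsD(2)[OF g, of "S - Z"] 
      by (intro emeasure_Un_null_set) (auto intro: null_sets_completion_subset)
    also have "\<dots> = emeasure ?C (g ` S)" by (rule emeasure_gms_image_Diff_null[OF g S Z])
    finally show ?thesis .
  qed
  have "absolutely_continuous ?C (distr ?C ?C k)"
    unfolding absolutely_continuous_def
  proof
    fix A assume A: "A \<in> null_sets ?C"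
    then have "emeasure (distr ?C ?C k) A = 0"
      using k[OF null_setsD2[OF A]] null_setsD1[OF gmsD(3)[OF g A]] by simp
    then show "A \<in> null_sets (distr ?C ?C k)" using null_setsD2[OF A] by (intro null_setsI) simp_all
  qed
  from C.Radon_Nikodym[OF this] obtain u where u[measurable]: "u \<in> borel_measurable ?C" and du: "density ?C u = distr ?C ?C k"
    by auto
  have uS: "emeasure ?C (g ` S) = (\<integral>\<^sup>+a\<in>S. u a \<partial>?C)" if "S \<in> sets ?C" for S
    using that k[OF that] by (simp add: du[symmetric] emeasure_density)
  have "(\<integral>\<^sup>+a. u a \<partial>?C) = emeasure ?C (g ` space M)"
    by (subst uS) (auto intro!: nn_integral_cong)
  also have "\<dots> \<noteq> \<infinity>" by simp
  finally have fin: "AE a in ?C. u a \<noteq> \<infinity>" by (intro nn_integral_PInf_AE) auto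
  let ?N = "{a\<in>space ?C. u a = 0}"
  have "emeasure ?C (g ` ?N) = 0"
  proof -
    have "emeasure ?C (g ` ?N) = (\<integral>\<^sup>+a\<in>?N. u a \<partial>?C)" by (rule uS) measurable
    also have "\<dots> = (\<integral>\<^sup>+a. 0 \<partial>?C)" by (intro nn_integral_cong) (auto split: split_indicator)
    finally show ?thesis by simp
  qed
  moreover have "?N \<in> sets ?C" by measurable
  ultimately have "g ` ?N \<in> null_sets ?C" using gmsD(2)[OF g] by (intro null_setsI) blast+
  from gmsD(4)[OF g this] have N0: "?N \<in> null_sets ?C"
    by (rule null_sets_completion_subset[rotated]) auto
  have pos: "AE a in ?C. u a \<noteq> 0" using AE_not_in[OF N0] AE_space by eventually_elim auto
  \<comment> \<open>Finite and positive almost everywhere; the value 1 elsewhere is arbitrary.\<close>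
  define d where "d a = (if u a = 0 \<or> u a = \<infinity> then 1 else enn2real (u a))" for a
  have "AE a in ?C. ennreal (d a) = u a"
    using pos fin by eventually_elim (auto simp: d_def ennreal_enn2real_if)
  then have "(\<integral>\<^sup>+ a \<in> S. ennreal (d a) \<partial>?C) = (\<integral>\<^sup>+ a \<in> S. u a \<partial>?C)" for S
    by (intro nn_integral_cong_AE) auto
  moreover have "d \<in> borel_measurable ?C" unfolding d_def[abs_def] by measurable
  moreover have "0 < d a" for a
    by (auto simp: d_def enn2real_positive_iff less_top[symmetric] zero_less_iff_neq_zero)
  ultimately show ?thesis using uS by (intro exI[of _ d]) simp
qed

lemma gms_deriv:
  assumes "finite_measure M" and "g \<in> gms M"
  shows gms_deriv_measurable: "gms_deriv M g \<in> borel_measurable (completion M)"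
    and gms_deriv_pos: "0 < gms_deriv M g a"
    and emeasure_gms_image: "S \<in> sets (completion M) \<Longrightarrow>
      emeasure (completion M) (g ` S) = (\<integral>\<^sup>+ a \<in> S. ennreal (gms_deriv M g a) \<partial>completion M)"
  using someI_ex[OF gms_deriv_exists[OF assms]] unfolding gms_deriv_def[symmetric] by auto

lemma gms_deriv_unique:
  assumes "finite_measure M" and g: "g \<in> gms M" and d[measurable]: "d \<in> borel_measurable (completion M)"
    and *: "\<And>S. S \<in> sets (completion M) \<Longrightarrow>
      emeasure (completion M) (g ` S) = (\<integral>\<^sup>+ a \<in> S. ennreal (d a) \<partial>completion M)"
    and pos: "\<And>a. 0 < d a"
  shows "AE a in M. gms_deriv M g a = d a"
proof -
  interpret finite_measure M by fact
  interpret C: finite_measure "completion M"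
    by (intro finite_measureI) (simp add: emeasure_eq_measure)
  note [measurable] = gms_deriv_measurable[OF assms(1,2)]
  have "AE a in completion M. ennreal (gms_deriv M g a) = ennreal (d a)"
    by (intro C.density_unique_finite_measure)
       (auto simp: *[symmetric] emeasure_gms_image[OF assms(1,2), symmetric])
  then show ?thesis
    unfolding AE_completion_iff using pos gms_deriv_pos[OF assms(1,2)]
    by (auto simp: less_imp_le)
qed

lemma pol_space_projections:
  "(\<lambda>(a, b, t). a) \<in> measurable (pol_space M) M"
  "(\<lambda>(a, b, t). b) \<in> measurable (pol_space M) M"
  "(\<lambda>(a, b, t). t) \<in> measurable (pol_space M) pos_reals"
proof -
  have "(\<lambda>x. fst x) \<in> measurable (pol_space M) M" by (rule measurable_fst)
  then show "(\<lambda>(a, b, t). a) \<in> measurable (pol_space M) M" by (simp add: split_beta')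
  have "(\<lambda>x. fst (snd x)) \<in> measurable (pol_space M) M"
    by (rule measurable_compose[OF measurable_snd measurable_fst])
  then show "(\<lambda>(a, b, t). b) \<in> measurable (pol_space M) M" by (simp add: split_beta')
  have "(\<lambda>x. snd (snd x)) \<in> measurable (pol_space M) pos_reals"
    by (rule measurable_compose[OF measurable_snd measurable_snd])
  then show "(\<lambda>(a, b, t). t) \<in> measurable (pol_space M) pos_reals" by (simp add: split_beta')
qed

lemma pos_reals_ennreal_measurable: "ennreal \<in> borel_measurable pos_reals"
  by (rule measurable_restrict_space1) measurable

lemma pol_space_ennreal_measurable: "(\<lambda>(a, b, t). ennreal t) \<in> borel_measurable (pol_space M)"
  using measurable_compose[OF pol_space_projections(3) pos_reals_ennreal_measurable]
  by (simp add: split_beta')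

lemma pol_space_weight_measurable:
  assumes "T \<in> sets M"
  shows "(\<lambda>(a, b, t). ennreal t * indicator T b) \<in> borel_measurable (pol_space M)"
proof -
  have "(indicator T :: _ \<Rightarrow> ennreal) \<in> borel_measurable M" using assms by simp
  from borel_measurable_times_ennreal[OF pol_space_ennreal_measurable measurable_compose[OF pol_space_projections(2) this]]
  show ?thesis by (simp add: split_beta')
qed

lemma emeasure_distr_density_second:
  assumes sP: "sets P = sets (pol_space M)" and T: "T \<in> sets M"
  shows "emeasure (distr (density P (\<lambda>(a, b, t). ennreal t)) M (\<lambda>(a, b, t). b)) T
    = (\<integral>\<^sup>+(a, b, t). ennreal t * indicator T b \<partial>P)"
proof -
  have m2: "(\<lambda>(a, b, t). b) \<in> measurable P M" and m3: "(\<lambda>(a, b, t). ennreal t) \<in> borel_measurable P"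
    using pol_space_projections(2)[of M] pol_space_ennreal_measurable[of M]
    by (simp_all only: measurable_cong_sets[OF sP refl])
  have m2': "(\<lambda>(a, b, t). b) \<in> measurable (density P (\<lambda>(a, b, t). ennreal t)) M"
    using m2 by (simp only: measurable_cong_sets[OF sets_density refl])
  have "emeasure (distr (density P (\<lambda>(a, b, t). ennreal t)) M (\<lambda>(a, b, t). b)) T
      = emeasure (density P (\<lambda>(a, b, t). ennreal t)) ((\<lambda>(a, b, t). b) -` T \<inter> space P)"
    by (simp only: emeasure_distr[OF m2' T] space_density)
  also have "\<dots> = (\<integral>\<^sup>+x. (case x of (a, b, t) \<Rightarrow> ennreal t) * indicator ((\<lambda>(a, b, t). b) -` T \<inter> space P) x \<partial>P)"
    by (rule emeasure_density[OF m3 measurable_sets[OF m2 T]])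
  also have "\<dots> = (\<integral>\<^sup>+(a, b, t). ennreal t * indicator T b \<partial>P)"
    by (intro nn_integral_cong) (simp add: split_beta' indicator_def)
  finally show ?thesis .
qed

lemma pol_of_gms_map_measurable:
  assumes "finite_measure M" and "g \<in> gms M"
  shows "(\<lambda>a. (a, g a, gms_deriv M g a)) \<in> measurable (completion M) (pol_space M)"
proof -
  have id: "(\<lambda>a. a) \<in> measurable (completion M) M"
    by (rule measurable_completion) simp
  have "g \<in> measurable (completion M) M"
    using measurable_compose[OF gmsD(1)[OF assms(2)] id] by simp
  moreover have "gms_deriv M g \<in> measurable (completion M) pos_reals"
    using gms_deriv_measurable[OF assms] gms_deriv_pos[OF assms] by (intro measurable_restrict_space2) auto
  ultimately show ?thesis using id by (intro measurable_Pair) auto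
qed

lemma pol_of_gms_rectangle:
  assumes "finite_measure M" and "g \<in> gms M" and "S \<in> sets M" "T \<in> sets M" "E \<in> sets pos_reals"
  shows "emeasure (pol_of_gms M g) (S \<times> T \<times> E) =
    emeasure (completion M) {a\<in>space M. a \<in> S \<and> g a \<in> T \<and> gms_deriv M g a \<in> E}"
  unfolding pol_of_gms_def using assms(3-5)
  by (subst emeasure_distr[OF pol_of_gms_map_measurable[OF assms(1,2)]])
     (auto intro!: arg_cong[where f="emeasure (completion M)"])

text \<open>The second marginal of the weighted graph measure gives \<open>T\<close> the mass \<open>\<integral> g' d\<alpha>\<close> over \<open>g\<inverse> T\<close>, which is
\<open>\<alpha>(g (g\<inverse> T))\<close>; this is \<open>\<alpha>(T)\<close> because \<open>g\<close> is onto up to a null set.\<close>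

lemma pol_of_gms_in_pol:
  assumes "finite_measure M" and g: "g \<in> gms M"
  shows "pol_of_gms M g \<in> pol M"
proof -
  let ?C = "completion M" and ?P = "pol_of_gms M g"
  note m = pol_of_gms_map_measurable[OF assms]
  have sP: "sets ?P = sets (pol_space M)" by (simp add: pol_of_gms_def)
  have id: "(\<lambda>a. a) \<in> measurable ?C M"
    by (rule measurable_completion) simp
  have 1: "distr ?P M (\<lambda>(a, b, t). a) = M"
  proof -
    have "distr ?P M (\<lambda>(a, b, t). a) = distr ?C M (\<lambda>a. a)"
      unfolding pol_of_gms_def by (subst distr_distr[OF pol_space_projections(1) m]) (simp add: o_def)
    also have "\<dots> = M" by (subst distr_completion) (auto simp: distr_id)
    finally show ?thesis .
  qed
  have "distr (density ?P (\<lambda>(a, b, t). ennreal t)) M (\<lambda>(a, b, t). b) = M" (is "?D = _")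
  proof (rule measure_eqI)
    fix T assume "T \<in> sets ?D"
    then have T: "T \<in> sets M" by simp
    have TC: "T \<in> sets ?C" using T by (rule sets_completionI_sets)
    have gT: "g -` T \<inter> space M \<in> sets ?C" using measurable_sets[OF gmsD(1)[OF g] TC] by (simp only: space_completion)
    obtain Z Z' where Z: "Z \<in> null_sets ?C" and Z': "Z' \<in> null_sets ?C"
      and bij: "bij_betw g (space M - Z) (space M - Z')"
      using gms_obtain_bij[OF g] .
    have "emeasure ?D T = (\<integral>\<^sup>+(a, b, t). ennreal t * indicator T b \<partial>?P)"
      using sP T by (rule emeasure_distr_density_second)
    also have "\<dots> = (\<integral>\<^sup>+a. ennreal (gms_deriv M g a) * indicator T (g a) \<partial>?C)"
      unfolding pol_of_gms_def by (subst nn_integral_distr[OF m]) (simp_all only: measurable_distr_eq1 pol_space_weight_measurable[OF T] prod.case)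
    also have "\<dots> = (\<integral>\<^sup>+a\<in>g -` T \<inter> space M. ennreal (gms_deriv M g a) \<partial>?C)"
      by (intro nn_integral_cong) (auto split: split_indicator)
    also have "\<dots> = emeasure ?C (g ` (g -` T \<inter> space M))"
      by (rule emeasure_gms_image[OF assms gT, symmetric])
    also have "\<dots> = emeasure ?C T"
    proof (rule emeasure_eq_AE)
      show "AE y in ?C. (y \<in> g ` (g -` T \<inter> space M)) = (y \<in> T)"
        using AE_not_in[OF Z'] AE_space
      proof eventually_elim
        fix y assume "y \<notin> Z'" "y \<in> space ?C"
        then have "y \<in> g ` (space M - Z)" using bij by (simp add: bij_betw_def)
        then show "(y \<in> g ` (g -` T \<inter> space M)) = (y \<in> T)" by blast
      qed
    qed (fact gmsD(2)[OF g gT] TC)+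
    finally show "emeasure ?D T = emeasure M T" using T TC by simp
  qed simp
  then show ?thesis using 1 sP by (simp add: pol_def)
qed

section \<open>Interval coordinates\<close>

text \<open>A measure preserving coordinate with values in an interval, injective on a set \<open>X\<close> of full measure.
It is measurable for the given sigma-algebra of \<open>M\<close> and not only for the completion, so preimages of
intervals are admissible blocks for polymorphisms, whose sigma-algebra is built from that of \<open>M\<close>.\<close>

locale interval_coordinate = finite_measure M for M :: "'a measure" +
  fixes f :: "'a \<Rightarrow> real" and L :: real and X :: "'a set"
  assumes L_pos: "0 < L"
    and f_measurable: "f \<in> borel_measurable M"
    and f_range: "x \<in> space M \<Longrightarrow> f x \<in> {0..<L}"
    and X_sets: "X \<in> sets M" and X_conull: "space M - X \<in> null_sets M"
    and f_inj: "inj_on f X"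
    and f_image: "S \<in> sets M \<Longrightarrow> S \<subseteq> X \<Longrightarrow> f ` S \<in> sets lebesgue"
    and f_law: "B \<in> sets borel \<Longrightarrow> B \<subseteq> {0..<L} \<Longrightarrow> emeasure M (f -` B \<inter> space M) = emeasure lborel B"
begin

lemma X_space: "X \<subseteq> space M"
  using X_sets by (rule sets.sets_into_space)

lemma vimage_null:
  assumes "N \<in> null_sets lebesgue"
  shows "f -` N \<inter> space M \<in> null_sets (completion M)"
proof -
  obtain N' where N': "N' \<in> null_sets lborel" "N \<subseteq> N'"
    using assms unfolding null_sets_completion_iff2 by blast
  have b: "N' \<in> sets borel" using null_setsD2[OF N'(1)] by (simp only: sets_lborel)
  have "emeasure M (f -` (N' \<inter> {0..<L}) \<inter> space M) = emeasure lborel (N' \<inter> {0..<L})"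
    using b by (intro f_law) auto
  also have "\<dots> = 0" by (rule emeasure_eq_0[OF null_setsD2[OF N'(1)] null_setsD1[OF N'(1)]]) auto
  also have "f -` (N' \<inter> {0..<L}) \<inter> space M = f -` N' \<inter> space M" using f_range by auto
  finally have "f -` N' \<inter> space M \<in> null_sets M"
    using measurable_sets[OF f_measurable b] by (intro null_setsI)
  from null_sets_completionI[OF this] show ?thesis
    by (rule null_sets_completion_subset[rotated]) (use N'(2) in auto)
qed

lemma vimage_lebesgue:
  assumes "B \<in> sets lebesgue"
  shows "f -` B \<inter> space M \<in> sets (completion M)"
    and "B \<subseteq> {0..<L} \<Longrightarrow> emeasure (completion M) (f -` B \<inter> space M) = emeasure lebesgue B"
proof -
  obtain S N N' where B: "B = S \<union> N" "N \<subseteq> N'" "N' \<in> null_sets lborel" "S \<in> sets lborel"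
    using assms by (rule sets_completionE)
  then have Sb: "S \<in> sets borel" by simp
  have N: "N \<in> null_sets lebesgue" unfolding null_sets_completion_iff2 using B by blast
  have v: "f -` B \<inter> space M = (f -` S \<inter> space M) \<union> (f -` N \<inter> space M)" using B(1) by blast
  have S: "f -` S \<inter> space M \<in> sets M" by (rule measurable_sets[OF f_measurable Sb])
  show "f -` B \<inter> space M \<in> sets (completion M)"
    unfolding v using S vimage_null[OF N] by (intro sets.Un) (auto simp: null_setsD2)
  assume "B \<subseteq> {0..<L}"
  then have SL: "S \<subseteq> {0..<L}" using B(1) by blast
  have "emeasure (completion M) (f -` B \<inter> space M) = emeasure (completion M) (f -` S \<inter> space M)"
    unfolding v by (rule emeasure_Un_null_set) (use S vimage_null[OF N] in auto)
  also have "\<dots> = emeasure lborel S" using S f_law[OF Sb SL] by simp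
  also have "\<dots> = emeasure lebesgue S" using Sb by simp
  also have "\<dots> = emeasure lebesgue B" unfolding B(1) by (rule emeasure_Un_null_set[symmetric]) (use Sb N in auto)
  finally show "emeasure (completion M) (f -` B \<inter> space M) = emeasure lebesgue B" .
qed

lemma null_lebesgue_if_vimage_null:
  assumes B: "B \<in> sets lebesgue" "B \<subseteq> {0..<L}" and N: "N \<in> null_sets (completion M)"
    and sub: "f -` B \<inter> space M \<subseteq> N"
  shows "B \<in> null_sets lebesgue"
proof -
  have "f -` B \<inter> space M \<in> null_sets (completion M)"
    using sub N by (rule null_sets_completion_subset)
  then show ?thesis using vimage_lebesgue(2)[OF B] B(1) by (intro null_setsI) (simp_all only: null_setsD1)
qed

lemma X_compl_null: "space M - X \<in> null_sets (completion M)"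
  using X_conull by (rule null_sets_completionI)

text \<open>If \<open>f ` N\<close> had positive measure, so would its preimage, which is contained in \<open>N\<close> up to the null set
where \<open>f\<close> may fail to be injective.\<close>

lemma image_null:
  assumes "N \<in> null_sets (completion M)" "N \<subseteq> X"
  shows "f ` N \<in> null_sets lebesgue"
proof -
  obtain N' where N': "N' \<in> null_sets M" "N \<subseteq> N'"
    using assms(1) unfolding null_sets_completion_iff2 by blast
  let ?N = "N' \<inter> X"
  have s: "?N \<in> sets M" using N'(1) X_sets by auto
  have "f ` ?N \<in> null_sets lebesgue"
  proof (rule null_lebesgue_if_vimage_null)
    show "f ` ?N \<in> sets lebesgue" using s by (intro f_image) auto
    show "f ` ?N \<subseteq> {0..<L}" using f_range X_space by auto
    show "N' \<union> (space M - X) \<in> null_sets (completion M)"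
      using N'(1) X_compl_null by (auto intro: null_sets.Un null_sets_completionI)
    show "f -` f ` ?N \<inter> space M \<subseteq> N' \<union> (space M - X)"
      using f_inj by (auto dest: inj_onD)
  qed
  then show ?thesis by (rule null_sets_completion_subset[rotated]) (use N'(2) assms(2) in auto)
qed

lemma image_lebesgue:
  assumes "S \<in> sets (completion M)" "S \<subseteq> X"
  shows "f ` S \<in> sets lebesgue"
proof -
  obtain S0 N N' where S: "S = S0 \<union> N" "N \<subseteq> N'" "N' \<in> null_sets M" "S0 \<in> sets M"
    using assms(1) by (rule sets_completionE)
  have "N \<in> null_sets (completion M)" unfolding null_sets_completion_iff2 using S by blast
  then have "f ` N \<in> sets lebesgue" using S(1) assms(2) by (intro null_setsD2[OF image_null]) auto
  moreover have "f ` S0 \<in> sets lebesgue" using S assms(2) by (intro f_image) auto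
  ultimately show ?thesis unfolding S(1) image_Un by (intro sets.Un)
qed

lemma image_conull:
  assumes "Y \<in> sets (completion M)" "Y \<subseteq> X" and Y: "space M - Y \<in> null_sets (completion M)"
  shows "{0..<L} - f ` Y \<in> null_sets lebesgue"
proof (rule null_lebesgue_if_vimage_null[OF _ _ Y])
  show "{0..<L} - f ` Y \<in> sets lebesgue" using image_lebesgue[OF assms(1,2)] by auto
qed auto

lemma nn_integral_coordinate:
  assumes u: "u \<in> borel_measurable borel"
  shows "(\<integral>\<^sup>+x. u (f x) \<partial>M) = (\<integral>\<^sup>+y\<in>{0..<L}. u y \<partial>lborel)"
proof -
  have "distr M borel f = density lborel (indicator {0..<L})"
  proof (rule measure_eqI)
    fix B assume "B \<in> sets (distr M borel f)"
    then have B: "B \<in> sets borel" by simp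
    have "emeasure (distr M borel f) B = emeasure M (f -` (B \<inter> {0..<L}) \<inter> space M)"
      using f_range by (subst emeasure_distr[OF f_measurable B]) (auto intro!: arg_cong[where f="emeasure M"])
    also have "\<dots> = emeasure lborel (B \<inter> {0..<L})" using B by (intro f_law) auto
    also have "\<dots> = emeasure (density lborel (indicator {0..<L})) B"
      using B by (subst emeasure_density) (auto simp: nn_integral_indicator[symmetric] indicator_inter_arith mult.commute simp del: nn_integral_indicator)
    finally show "emeasure (distr M borel f) B = emeasure (density lborel (indicator {0..<L})) B" .
  qed simp
  then have "(\<integral>\<^sup>+y. u y \<partial>distr M borel f) = (\<integral>\<^sup>+y. u y \<partial>density lborel (indicator {0..<L}))" by simp
  then show ?thesis using u
    by (simp add: nn_integral_distr[OF f_measurable] nn_integral_density mult.commute)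
qed

end

section \<open>Conjugation of interval automorphisms by a coordinate\<close>

text \<open>The conclusion of the block construction, seen as a structure: a Borel bijection of the interval with
a positive density for the measure of images. Positivity of the density makes preimages of null
sets null, and together with completeness everything extends from Borel to Lebesgue sets.\<close>

locale interval_automorphism =
  fixes h D :: "real \<Rightarrow> real" and L :: real
  assumes h_borel: "h \<in> borel_measurable borel" and D_borel: "D \<in> borel_measurable borel"
    and D_pos: "0 < D x" and h_bij: "bij_betw h {0..<L} {0..<L}"
    and h_image_borel: "E \<in> sets borel \<Longrightarrow> E \<subseteq> {0..<L} \<Longrightarrow> h ` E \<in> sets borel"
    and h_image_emeasure: "E \<in> sets borel \<Longrightarrow> E \<subseteq> {0..<L} \<Longrightarrow>
      emeasure lborel (h ` E) = (\<integral>\<^sup>+x\<in>E. ennreal (D x) \<partial>lborel)"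
begin

lemma h_image_null:
  assumes "N \<in> null_sets lebesgue" "N \<subseteq> {0..<L}"
  shows "h ` N \<in> null_sets lebesgue"
proof -
  obtain N' where N': "N' \<in> null_sets lborel" "N \<subseteq> N'"
    using assms(1) unfolding null_sets_completion_iff2 by blast
  let ?N = "N' \<inter> {0..<L}"
  have b: "?N \<in> sets borel" and n: "?N \<in> null_sets lborel" using null_setsD2[OF N'(1)] null_set_Int2[OF N'(1), of "{0..<L}"] by (auto simp: Int_commute)
  have "AE x in lborel. ennreal (D x) * indicator ?N x = 0"
    using AE_not_in[OF n] by eventually_elim auto
  then have "(\<integral>\<^sup>+x. ennreal (D x) * indicator ?N x \<partial>lborel) = (\<integral>\<^sup>+x. 0 \<partial>(lborel :: real measure))"
    by (rule nn_integral_cong_AE)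
  then have "emeasure lborel (h ` ?N) = 0"
    using h_image_emeasure[OF b] by simp
  then have "h ` ?N \<in> null_sets lborel" using h_image_borel[OF b] by (intro null_setsI) auto
  from null_sets_completionI[OF this] show ?thesis
    by (rule null_sets_completion_subset[rotated]) (use N'(2) assms(2) in auto)
qed

lemma h_image_lebesgue:
  assumes "E \<in> sets lebesgue" "E \<subseteq> {0..<L}"
  obtains B N where "E = B \<union> N" "B \<in> sets borel" "B \<subseteq> {0..<L}" "N \<in> null_sets lebesgue"
    "h ` E \<in> sets lebesgue" "emeasure lebesgue (h ` E) = (\<integral>\<^sup>+x\<in>B. ennreal (D x) \<partial>lborel)"
proof -
  obtain B N N' where E: "E = B \<union> N" "N \<subseteq> N'" "N' \<in> null_sets lborel" "B \<in> sets lborel"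
    using assms(1) by (rule sets_completionE)
  have N: "N \<in> null_sets lebesgue" unfolding null_sets_completion_iff2 using E by blast
  have hN: "h ` N \<in> null_sets lebesgue" using N E(1) assms(2) by (intro h_image_null) auto
  have B: "B \<in> sets borel" "B \<subseteq> {0..<L}" using E(1,4) assms(2) by auto
  note hB = h_image_borel[OF B]
  have "h ` E = h ` B \<union> h ` N" using E(1) by blast
  moreover have "emeasure lebesgue (h ` B \<union> h ` N) = emeasure lebesgue (h ` B)"
    using hB hN by (intro emeasure_Un_null_set) auto
  moreover have "emeasure lebesgue (h ` B) = (\<integral>\<^sup>+x\<in>B. ennreal (D x) \<partial>lborel)"
    using h_image_emeasure[OF B] hB by simp
  moreover have "h ` B \<union> h ` N \<in> sets lebesgue" using hB null_setsD2[OF hN] by (intro sets.Un) auto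
  ultimately show ?thesis using that[OF E(1) B N] by simp
qed

lemma h_vimage_null:
  assumes "N \<in> null_sets lebesgue"
  shows "{x\<in>{0..<L}. h x \<in> N} \<in> null_sets lebesgue"
proof -
  obtain N' where N': "N' \<in> null_sets lborel" "N \<subseteq> N'"
    using assms(1) unfolding null_sets_completion_iff2 by blast
  let ?P = "{0..<L} \<inter> h -` N'"
  have N'b: "N' \<in> sets borel" using null_setsD2[OF N'(1)] by (simp only: sets_lborel)
  have P: "?P \<in> sets borel" using measurable_sets[OF h_borel N'b] by (intro sets.Int) auto
  have "emeasure lborel (h ` ?P) = 0"
    by (rule emeasure_eq_0[OF null_setsD2[OF N'(1)] null_setsD1[OF N'(1)]]) auto
  then have "(\<integral>\<^sup>+x\<in>?P. ennreal (D x) \<partial>lborel) = 0"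
    by (subst h_image_emeasure[OF P, symmetric]) auto
  then have "AE x in lborel. ennreal (D x) * indicator ?P x = 0"
    using D_borel P by (subst (asm) nn_integral_0_iff_AE) auto
  then have "AE x in lborel. x \<notin> ?P"
  proof eventually_elim
    fix x assume "ennreal (D x) * indicator ?P x = 0"
    then show "x \<notin> ?P" using D_pos[of x] by (auto simp: indicator_def ennreal_eq_0_iff split: if_splits)
  qed
  then have "?P \<in> null_sets lborel"
    using P by (subst (asm) AE_iff_null_sets[symmetric]) auto
  from null_sets_completionI[OF this] show ?thesis
    by (rule null_sets_completion_subset[rotated]) (use N'(2) in auto)
qed

lemma h_vimage_lebesgue:
  assumes "E \<in> sets lebesgue"
  shows "{x\<in>{0..<L}. h x \<in> E} \<in> sets lebesgue"
proof -
  obtain B N N' where E: "E = B \<union> N" "N \<subseteq> N'" "N' \<in> null_sets lborel" "B \<in> sets lborel"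
    using assms(1) by (rule sets_completionE)
  have N: "N \<in> null_sets lebesgue" unfolding null_sets_completion_iff2 using E by blast
  have B: "B \<in> sets borel" using E(4) by simp
  have "{0..<L} \<inter> h -` B \<in> sets borel" using measurable_sets[OF h_borel B] by (intro sets.Int) auto
  then have "{0..<L} \<inter> h -` B \<in> sets lebesgue" by simp
  moreover have "{x\<in>{0..<L}. h x \<in> E} = ({0..<L} \<inter> h -` B) \<union> {x\<in>{0..<L}. h x \<in> N}" using E(1) by blast
  ultimately show ?thesis using null_setsD2[OF h_vimage_null[OF N]] by simp
qed

end

text \<open>An automorphism of the interval is conjugated by the coordinate \<open>f\<close>. The conjugate makes sense at the
points of \<open>core\<close>, whose image under \<open>h\<close> is again a coordinate of a point of \<open>X\<close>. These points have
full measure; on the null set left over, the conjugate is taken to be the identity, which maps null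
sets to null sets.\<close>

locale coordinate_automorphism = interval_coordinate M f L X + interval_automorphism h D L
  for M :: "'a measure" and f L X h D
begin

definition core :: "'a set" where
  "core = {x\<in>X. h (f x) \<in> f ` X}"

definition transport :: "'a \<Rightarrow> 'a" where
  "transport x = (if x \<in> core then the_inv_into X f (h (f x)) else x)"

lemma f_in: "x \<in> X \<Longrightarrow> f x \<in> {0..<L}"
  using f_range X_space by auto

lemma transport_core: "x \<in> core \<Longrightarrow> transport x \<in> X \<and> f (transport x) = h (f x)"
  using the_inv_into_into[OF f_inj _ order_refl] f_the_inv_into_f[OF f_inj]
  by (auto simp: core_def transport_def)

lemma core_X: "core \<subseteq> X" by (auto simp: core_def)

lemma f_image_X: "f ` X \<in> sets lebesgue"
  using X_sets by (intro f_image) auto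

lemma core_vimage: "core = X \<inter> (f -` {y\<in>{0..<L}. h y \<in> f ` X} \<inter> space M)"
  using f_in X_space by (auto simp: core_def)

lemma core_sets: "core \<in> sets (completion M)"
  unfolding core_vimage 
  by (rule sets.Int[OF sets_completionI_sets[OF X_sets] vimage_lebesgue(1)[OF h_vimage_lebesgue[OF f_image_X]]])

lemma core_conull: "space M - core \<in> null_sets (completion M)"
proof -
  have 1: "{0..<L} - f ` X \<in> null_sets lebesgue"
    using X_sets X_compl_null by (intro image_conull) auto
  have "f -` {y\<in>{0..<L}. h y \<in> {0..<L} - f ` X} \<inter> space M \<in> null_sets (completion M)"
    by (rule vimage_null[OF h_vimage_null[OF 1]])
  then have "(space M - X) \<union> (f -` {y\<in>{0..<L}. h y \<in> {0..<L} - f ` X} \<inter> space M) \<in> null_sets (completion M)"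
    using X_compl_null by (intro null_sets.Un)
  moreover have "space M - core \<subseteq> (space M - X) \<union> (f -` {y\<in>{0..<L}. h y \<in> {0..<L} - f ` X} \<inter> space M)"
  proof (intro subsetI, rule ccontr)
    fix x assume "x \<in> space M - core"
      "x \<notin> (space M - X) \<union> (f -` {y\<in>{0..<L}. h y \<in> {0..<L} - f ` X} \<inter> space M)"
    then have x: "x \<in> space M" "x \<notin> core" "\<not> (x \<in> f -` {y\<in>{0..<L}. h y \<in> {0..<L} - f ` X})" "x \<in> X" by blast+
    have "h (f x) \<in> {0..<L}" using imageI[OF f_in[OF x(4)], of h] h_bij by (simp only: bij_betw_def)
    then show False using x f_in by (auto simp: core_def)
  qed
  ultimately show ?thesis by (rule null_sets_completion_subset[rotated])
qed

lemma transport_image: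
  assumes "S \<subseteq> core"
  shows "transport ` S = X \<inter> (f -` (h ` f ` S) \<inter> space M)"
proof (intro set_eqI iffI)
  fix x assume "x \<in> transport ` S"
  then obtain s where "s \<in> S" "x = transport s" by blast
  then show "x \<in> X \<inter> (f -` (h ` f ` S) \<inter> space M)" using transport_core[of s] assms X_space by auto
next
  fix x assume x: "x \<in> X \<inter> (f -` (h ` f ` S) \<inter> space M)"
  then obtain s where s: "s \<in> S" "f x = h (f s)" by blast
  then have "transport s \<in> X" "f (transport s) = f x" using transport_core[of s] assms by auto
  then have "x = transport s" using f_inj x by (auto dest: inj_onD)
  then show "x \<in> transport ` S" using s by blast
qed

lemma transport_image_sets:
  assumes S: "S \<in> sets (completion M)" "S \<subseteq> core"
  shows "transport ` S \<in> sets (completion M)"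
    and "emeasure (completion M) (transport ` S) = (\<integral>\<^sup>+x\<in>S. ennreal (D (f x)) \<partial>completion M)"
proof -
  let ?C = "completion M"
  have SX: "S \<subseteq> X" using S(2) core_X by blast
  have E: "f ` S \<in> sets lebesgue" "f ` S \<subseteq> {0..<L}" using image_lebesgue[OF S(1) SX] f_in SX by auto
  obtain B N where B: "f ` S = B \<union> N" "B \<in> sets borel" "B \<subseteq> {0..<L}" "N \<in> null_sets lebesgue"
    "h ` f ` S \<in> sets lebesgue" "emeasure lebesgue (h ` f ` S) = (\<integral>\<^sup>+x\<in>B. ennreal (D x) \<partial>lborel)"
    using h_image_lebesgue[OF E] .
  note [measurable] = D_borel B(2)
  have hE: "h ` f ` S \<subseteq> {0..<L}" using E(2) h_bij by (auto simp: bij_betw_def)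
  note v = vimage_lebesgue(1)[OF B(5)]
  show s: "transport ` S \<in> sets ?C"
    unfolding transport_image[OF S(2)] by (rule sets.Int[OF sets_completionI_sets[OF X_sets] v])
  have "emeasure ?C (transport ` S) = emeasure ?C (f -` (h ` f ` S) \<inter> space M)"
  proof (rule emeasure_eq_AE)
    show "AE x in ?C. (x \<in> transport ` S) = (x \<in> f -` (h ` f ` S) \<inter> space M)"
      using AE_not_in[OF X_compl_null] AE_space unfolding transport_image[OF S(2)] by eventually_elim auto
  qed (fact s v)+
  also have "\<dots> = emeasure lebesgue (h ` f ` S)" by (rule vimage_lebesgue(2)[OF B(5) hE])
  also have "\<dots> = (\<integral>\<^sup>+x. ennreal (D x) * indicator B x \<partial>lborel)" by (rule B(6))
  also have "\<dots> = (\<integral>\<^sup>+y\<in>{0..<L}. ennreal (D y) * indicator B y \<partial>lborel)"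
    using B(3) by (intro nn_integral_cong) (auto split: split_indicator)
  also have "\<dots> = (\<integral>\<^sup>+x. ennreal (D (f x)) * indicator B (f x) \<partial>M)"
    by (rule nn_integral_coordinate[symmetric]) measurable
  also have "\<dots> = (\<integral>\<^sup>+x. ennreal (D (f x)) * indicator B (f x) \<partial>?C)"
    by (rule nn_integral_completion[symmetric])
  also have "\<dots> = (\<integral>\<^sup>+x\<in>S. ennreal (D (f x)) \<partial>?C)"
  proof (rule nn_integral_cong_AE)
    show "AE x in ?C. ennreal (D (f x)) * indicator B (f x) = ennreal (D (f x)) * indicator S x"
      using AE_not_in[OF X_compl_null] AE_not_in[OF vimage_null[OF B(4)]] AE_space
    proof eventually_elim
      fix x assume x: "x \<notin> space M - X" "x \<notin> f -` N \<inter> space M" "x \<in> space ?C"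
      then have "f x \<in> B \<longleftrightarrow> f x \<in> f ` S" using B(1) by auto
      also have "\<dots> \<longleftrightarrow> x \<in> S" using x f_inj SX by (auto dest: inj_onD)
      finally show "ennreal (D (f x)) * indicator B (f x) = ennreal (D (f x)) * indicator S x"
        by (simp add: indicator_def)
    qed
  qed
  finally show "emeasure ?C (transport ` S) = (\<integral>\<^sup>+x\<in>S. ennreal (D (f x)) \<partial>?C)" .
qed

lemma compl_core_null:
  "S \<in> sets (completion M) \<Longrightarrow> S - core \<in> null_sets (completion M)"
  using sets.sets_into_space[of S "completion M"]
  by (intro null_sets_completion_subset[OF _ core_conull]) auto

lemma transport_image_split:
  assumes "S \<in> sets (completion M)"
  shows "transport ` S = transport ` (S \<inter> core) \<union> (S - core)"
  by (auto simp: transport_def)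

lemma transport_in_gms: "transport \<in> gms M"
proof -
  let ?C = "completion M"
  have im: "transport ` S \<in> sets ?C" if "S \<in> sets ?C" for S
    unfolding transport_image_split[OF that]
    using that core_sets compl_core_null[OF that]
    by (intro sets.Un transport_image_sets) auto
  have imnull: "transport ` S \<in> null_sets ?C" if S: "S \<in> null_sets ?C" for S
  proof -
    have SC: "S \<in> sets ?C" using S by auto
    have n: "S \<inter> core \<in> null_sets ?C" using S by (rule null_sets_completion_subset[rotated]) auto
    have "emeasure ?C (transport ` (S \<inter> core)) = (\<integral>\<^sup>+x\<in>S \<inter> core. ennreal (D (f x)) \<partial>?C)"
      using n by (intro transport_image_sets(2)) auto
    also have "\<dots> = (\<integral>\<^sup>+x. 0 \<partial>?C)"
    proof (rule nn_integral_cong_AE)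
      show "AE x in ?C. ennreal (D (f x)) * indicator (S \<inter> core) x = 0"
        using AE_not_in[OF n] by eventually_elim simp
    qed
    finally have "transport ` (S \<inter> core) \<in> null_sets ?C"
      using n by (intro null_setsI transport_image_sets(1)) auto
    then show ?thesis
      unfolding transport_image_split[OF SC] using compl_core_null[OF SC] by (rule null_sets.Un)
  qed
  have vim: "transport -` S \<inter> space M = (core \<inter> (f -` {y\<in>{0..<L}. h y \<in> f ` (S \<inter> X)} \<inter> space M)) \<union> (S - core)"
    if "S \<in> sets ?C" for S
  proof (intro set_eqI)
    fix x
    have Ssp: "S \<subseteq> space M" using sets.sets_into_space[OF that] by simp
    show "x \<in> transport -` S \<inter> space M \<longleftrightarrow> x \<in> (core \<inter> (f -` {y\<in>{0..<L}. h y \<in> f ` (S \<inter> X)} \<inter> space M)) \<union> (S - core)"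
    proof (cases "x \<in> core")
      case True
      then have x: "x \<in> X" "x \<in> space M" "transport x \<in> X" "f (transport x) = h (f x)"
        using transport_core core_X X_space by auto
      have "transport x \<in> S \<longleftrightarrow> h (f x) \<in> f ` (S \<inter> X)"
      proof
        assume "transport x \<in> S"
        then show "h (f x) \<in> f ` (S \<inter> X)" unfolding x(4)[symmetric] using x(3) by blast
      next
        assume "h (f x) \<in> f ` (S \<inter> X)"
        then obtain s where "s \<in> S" "s \<in> X" "f (transport x) = f s" using x(4) by auto
        then show "transport x \<in> S" using inj_onD[OF f_inj, of "transport x" s] x(3) by simp
      qed
      then show ?thesis using True x f_in[OF x(1)] by simp
    next
      case False
      then show ?thesis using Ssp by (auto simp: transport_def)
    qed
  qed
  have meas: "transport \<in> measurable ?C ?C"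
  proof (rule measurableI)
    fix x assume "x \<in> space ?C"
    then show "transport x \<in> space ?C"
      using transport_core[of x] X_space by (cases "x \<in> core") (auto simp: transport_def)
  next
    fix S assume S: "S \<in> sets ?C"
    have "f ` (S \<inter> X) \<in> sets lebesgue" using S X_sets by (intro image_lebesgue) auto
    then have "f -` {y\<in>{0..<L}. h y \<in> f ` (S \<inter> X)} \<inter> space M \<in> sets ?C"
      by (intro vimage_lebesgue h_vimage_lebesgue)
    then show "transport -` S \<inter> space ?C \<in> sets ?C"
      unfolding space_completion vim[OF S]
      by (intro sets.Un sets.Int[OF core_sets] null_setsD2[OF compl_core_null[OF S]])
  qed
  have vimnull: "transport -` S \<inter> space M \<in> null_sets ?C" if S: "S \<in> null_sets ?C" for S
  proof -
    have "S \<inter> X \<in> null_sets ?C" using S by (rule null_sets_completion_subset[rotated]) auto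
    then have "f -` {y\<in>{0..<L}. h y \<in> f ` (S \<inter> X)} \<inter> space M \<in> null_sets ?C"
      by (intro vimage_null h_vimage_null image_null) auto
    then have "(f -` {y\<in>{0..<L}. h y \<in> f ` (S \<inter> X)} \<inter> space M) \<union> S \<in> null_sets ?C"
      using S by (rule null_sets.Un)
    then show ?thesis unfolding vim[OF null_setsD2[OF S]]
      by (rule null_sets_completion_subset[rotated]) auto
  qed
  let ?Z = "space M - core" and ?Z' = "space M - transport ` core"
  have inj: "inj_on transport core"
  proof (rule inj_onI)
    fix x y assume xy: "x \<in> core" "y \<in> core" "transport x = transport y"
    then have "h (f x) = h (f y)" using transport_core[of x] transport_core[of y] by simp
    then have "f x = f y"
      using inj_onD[OF bij_betw_imp_inj_on[OF h_bij]] f_in xy core_X by blast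
    then show "x = y" using f_inj xy core_X by (auto dest: inj_onD)
  qed
  have Z': "?Z' \<in> null_sets ?C"
  proof -
    have c: "{0..<L} - f ` core \<in> null_sets lebesgue"
      by (rule image_conull[OF core_sets core_X core_conull])
    have "f -` (h ` ({0..<L} - f ` core)) \<inter> space M \<in> null_sets ?C"
      by (rule vimage_null[OF h_image_null[OF c]]) auto
    then have "(f -` (h ` ({0..<L} - f ` core)) \<inter> space M) \<union> (space M - X) \<in> null_sets ?C"
      using X_compl_null by (rule null_sets.Un)
    moreover have "?Z' \<subseteq> (f -` (h ` ({0..<L} - f ` core)) \<inter> space M) \<union> (space M - X)"
    proof (intro subsetI, rule ccontr)
      fix x assume "x \<in> ?Z'" "x \<notin> (f -` (h ` ({0..<L} - f ` core)) \<inter> space M) \<union> (space M - X)"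
      then have x: "x \<in> space M" "x \<notin> transport ` core" "x \<notin> f -` (h ` ({0..<L} - f ` core))" "x \<in> X" by blast+
      then have "f x \<in> h ` {0..<L}" using f_in h_bij by (simp add: bij_betw_def)
      then have "f x \<in> h ` f ` core" using x(3) by auto
      then have "x \<in> transport ` core" unfolding transport_image[OF order_refl] using x by auto
      then show False using x by simp
    qed
    ultimately show ?thesis by (rule null_sets_completion_subset[rotated])
  qed
  have "bij_betw transport (space M - ?Z) (space M - ?Z')"
  proof -
    have "space M - ?Z = core" using core_X X_space by auto
    moreover have "space M - ?Z' = transport ` core" using transport_core X_space by auto
    ultimately show ?thesis using inj by (simp add: bij_betw_def)
  qed
  then show ?thesis
    unfolding gms_def mem_Collect_eq
    by (intro conjI ballI bexI[OF _ core_conull] bexI[OF _ Z'] meas im imnull vimnull)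
qed

lemma transport_coordinate: "AE x in M. f (transport x) = h (f x)"
proof -
  have "AE x in completion M. f (transport x) = h (f x)"
    using AE_not_in[OF core_conull] AE_space by eventually_elim (use transport_core in auto)
  then show ?thesis by (rule AE_completion_iff[THEN iffD1])
qed

lemma transport_deriv: "AE x in M. gms_deriv M transport x = D (f x)"
proof (rule gms_deriv_unique[OF _ transport_in_gms])
  show "finite_measure M" by (rule finite_measure_axioms)
  show "(\<lambda>x. D (f x)) \<in> borel_measurable (completion M)"
    by (rule measurable_completion[OF measurable_compose[OF f_measurable D_borel]])
  show "0 < D (f x)" for x by (rule D_pos)
  fix S assume S: "S \<in> sets (completion M)"
  have "S \<subseteq> space M" using sets.sets_into_space[OF S] by simp
  then have eq: "S - (space M - core) = S \<inter> core" by blast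
  have "emeasure (completion M) (transport ` S) = emeasure (completion M) (transport ` (S \<inter> core))"
    using emeasure_gms_image_Diff_null[OF transport_in_gms S core_conull] by (simp only: eq)
  also have "\<dots> = (\<integral>\<^sup>+x\<in>S \<inter> core. ennreal (D (f x)) \<partial>completion M)"
    using S core_sets by (intro transport_image_sets) auto
  also have "\<dots> = (\<integral>\<^sup>+x\<in>S. ennreal (D (f x)) \<partial>completion M)"
  proof (rule nn_integral_cong_AE)
    show "AE x in completion M. ennreal (D (f x)) * indicator (S \<inter> core) x = ennreal (D (f x)) * indicator S x"
      using AE_not_in[OF core_conull] AE_space by eventually_elim (auto simp: indicator_def)
  qed
  finally show "emeasure (completion M) (transport ` S) = (\<integral>\<^sup>+x\<in>S. ennreal (D (f x)) \<partial>completion M)" .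
qed

end

section \<open>Existence of a coordinate\<close>

text \<open>A point of the discrete part of the model has positive mass, so it is not removed by a null set, and
its preimage is an atom of \<open>M\<close>. If there are no atoms, the discrete part is therefore empty.\<close>

lemma lebesgue_space_without_atoms:
  fixes M :: "'a measure"
  assumes "lebesgue_space M" and "continuous_measure M"
  obtains L :: real and Z :: "'a set" and G :: "'a \<Rightarrow> real" where "0 \<le> L" "Z \<in> null_sets (completion M)" "inj_on G (space M - Z)"
    "\<forall>S. S \<subseteq> space M - Z \<longrightarrow> (S \<in> sets (completion M) \<longleftrightarrow> G ` S \<in> sets lebesgue)"
    "\<forall>S\<in>sets (completion M). S \<subseteq> space M - Z \<longrightarrow> emeasure lebesgue (G ` S) = emeasure (completion M) S"
    "G ` (space M - Z) \<subseteq> {0..L}" "{0..L} - G ` (space M - Z) \<in> null_sets lebesgue"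
proof -
  let ?C = "completion M"
  obtain L :: real and J :: "nat set" and w :: "nat \<Rightarrow> real" where L: "0 \<le> L" and w: "\<forall>n\<in>J. 0 < w n"
    and iso: "iso_mod0 ?C (disjoint_sum (lebesgue_on {0..L}) (point_measure J (\<lambda>n. ennreal (w n))))"
    using assms(1) unfolding lebesgue_space_def by blast
  define N where "N = disjoint_sum (lebesgue_on {0..L}) (point_measure J (\<lambda>n. ennreal (w n)))"
  obtain F Z Z' where Z: "Z \<in> null_sets ?C" and Z': "Z' \<in> null_sets N"
    and bij: "bij_betw F (space M - Z) (space N - Z')"
    and Fs: "\<forall>S. S \<subseteq> space M - Z \<longrightarrow> (S \<in> sets ?C \<longleftrightarrow> F ` S \<in> sets N)"
    and Fe: "\<forall>S\<in>sets ?C. S \<subseteq> space M - Z \<longrightarrow> emeasure N (F ` S) = emeasure ?C S"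
    using iso unfolding iso_mod0_def N_def[symmetric] space_completion by blast
  have "J = {}"
  proof (rule ccontr)
    assume "J \<noteq> {}"
    then obtain n where n: "n \<in> J" by blast
    have v: "Inl -` {Inr n} = {}" "Inr -` {Inr n} = {n}" by auto
    have s: "{Inr n} \<in> sets N"
      unfolding N_def sets_disjoint_sum using n by (simp add: v space_point_measure sets_point_measure InrI)
    have e: "emeasure N {Inr n} = ennreal (w n)"
      unfolding N_def using n by (subst emeasure_disjoint_sum[OF s[unfolded N_def]]) (simp add: v emeasure_point_measure_finite2)
    have "Inr n \<notin> Z'"
    proof
      assume "Inr n \<in> Z'"
      then have "emeasure N {Inr n} = 0"
        by (intro emeasure_eq_0[OF null_setsD2[OF Z'] null_setsD1[OF Z']]) simp
      moreover have "0 < w n" using w n by blast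
      ultimately show False using e by (simp add: ennreal_eq_0_iff)
    qed
    moreover have "Inr n \<in> space N" using sets.sets_into_space[OF s] by simp
    ultimately have "Inr n \<in> F ` (space M - Z)" using bij by (simp add: bij_betw_def)
    then obtain x where x: "x \<in> space M" "x \<notin> Z" "F x = Inr n" by auto
    then have "F ` {x} = {Inr n}" "{x} \<subseteq> space M - Z" by auto
    then have "{x} \<in> sets ?C" "emeasure ?C {x} = ennreal (w n)"
      using Fs[rule_format, of "{x}"] Fe[rule_format, of "{x}"] s e by simp_all
    moreover have "0 < w n" using w n by blast
    ultimately have "x \<in> atoms M" using x(1) by (simp add: atoms_def)
    then show False using assms(2) by (simp add: continuous_measure_def)
  qed
  have spN: "space N = Inl ` {0..L}"
    unfolding N_def space_disjoint_sum \<open>J = {}\<close> by (simp add: space_point_measure Plus_def space_restrict_space)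
  define G where "G x = projl (F x)" for x
  have FG: "F x = Inl (G x)" "G x \<in> {0..L}" if "x \<in> space M - Z" for x
  proof -
    have "F x \<in> Inl ` {0..L}" using bij that spN by (auto simp: bij_betw_def)
    then show "F x = Inl (G x)" "G x \<in> {0..L}" by (auto simp: G_def)
  qed
  have img: "F ` S = Inl ` G ` S" "G ` S \<subseteq> {0..L}" if "S \<subseteq> space M - Z" for S
  proof -
    show "F ` S = Inl ` G ` S" unfolding image_image using that FG(1) by (intro image_cong) auto
    show "G ` S \<subseteq> {0..L}" using FG(2) that by blast
  qed
  have sN: "Inl ` T \<in> sets N \<longleftrightarrow> T \<in> sets lebesgue" if "T \<subseteq> {0..L}" for T
  proof -
    have "Inl -` (Inl ` T :: (real + nat) set) = T" "Inr -` (Inl ` T :: (real + nat) set) = {}" by auto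
    moreover have "T \<in> sets (lebesgue_on {0..L}) \<longleftrightarrow> T \<in> sets lebesgue"
      using that by (simp add: sets_restrict_space_iff)
    moreover have "Inl ` T \<subseteq> space N" using that spN by auto
    ultimately show ?thesis unfolding N_def by (simp add: sets_disjoint_sum)
  qed
  have eN: "emeasure N (Inl ` T) = emeasure lebesgue T" if T: "T \<subseteq> {0..L}" "T \<in> sets lebesgue" for T
  proof -
    have v: "Inl -` (Inl ` T :: (real + nat) set) = T" "Inr -` (Inl ` T :: (real + nat) set) = {}" by auto
    have "Inl ` T \<in> sets N" using sN T by simp
    then have "emeasure N (Inl ` T) = emeasure (lebesgue_on {0..L}) T"
      unfolding N_def by (subst emeasure_disjoint_sum) (simp_all add: v)
    then show ?thesis using T by (simp add: emeasure_restrict_space)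
  qed
  show ?thesis
  proof (rule that[of L Z G])
    show "inj_on G (space M - Z)"
    proof (rule inj_onI)
      fix x y assume xy: "x \<in> space M - Z" "y \<in> space M - Z" "G x = G y"
      then have "F x = F y" using FG(1) by simp
      then show "x = y" using bij_betw_imp_inj_on[OF bij] xy by (simp only: inj_on_eq_iff)
    qed
    have *: "S \<in> sets ?C \<longleftrightarrow> G ` S \<in> sets lebesgue" if "S \<subseteq> space M - Z" for S
      using Fs that img[OF that] sN by simp
    then show "\<forall>S. S \<subseteq> space M - Z \<longrightarrow> (S \<in> sets ?C \<longleftrightarrow> G ` S \<in> sets lebesgue)" by blast
    have "emeasure lebesgue (G ` S) = emeasure ?C S" if "S \<in> sets ?C" "S \<subseteq> space M - Z" for S
      using Fe[rule_format, OF that] eN[OF img(2)[OF that(2)]] *[OF that(2)] that(1) img(1)[OF that(2)]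
      by (simp del: emeasure_completion)
    then show "\<forall>S\<in>sets ?C. S \<subseteq> space M - Z \<longrightarrow> emeasure lebesgue (G ` S) = emeasure ?C S" by blast
    have "F ` (space M - Z) = space N - Z'" using bij by (simp add: bij_betw_def)
    then have sub: "Inl ` ({0..L} - G ` (space M - Z)) \<subseteq> Z'"
      using img(1)[OF order_refl] spN by blast
    have "{0..L} - G ` (space M - Z) \<in> sets lebesgue"
    proof -
      have "space M - Z \<in> sets ?C" using Z by (metis null_setsD2 sets.compl_sets space_completion)
      then have "F ` (space M - Z) \<in> sets N" using Fs by simp
      then have "G ` (space M - Z) \<in> sets lebesgue" using img[OF order_refl] sN by simp
      then show ?thesis by (intro sets.Diff) simp_all
    qed
    moreover from this have "emeasure lebesgue ({0..L} - G ` (space M - Z)) = 0"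
      using eN emeasure_eq_0[OF null_setsD2[OF Z'] null_setsD1[OF Z'] sub] by simp
    ultimately show "{0..L} - G ` (space M - Z) \<in> null_sets lebesgue" by (intro null_setsI)
  qed (use L Z img(2)[OF order_refl] in auto)
qed

text \<open>The isomorphism with the interval is measurable only for the completion, and defined only almost
everywhere. It agrees almost everywhere with a function measurable for the sigma-algebra of \<open>M\<close>; \<open>X\<close>
consists of the points where the two agree and the isomorphism is defined. The right end point of
the interval is a null set and is dropped.\<close>

lemma lebesgue_space_coordinate:
  fixes M :: "'a measure"
  assumes "lebesgue_space M" and "continuous_measure M"
  obtains f L X where "interval_coordinate M f L X"
proof -
  let ?C = "completion M"
  have fin: "finite_measure M" and pos: "0 < emeasure M (space M)"
    using assms(1) by (simp_all add: lebesgue_space_def)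
  obtain L :: real and Z :: "'a set" and G :: "'a \<Rightarrow> real" where L: "0 \<le> L" and Z: "Z \<in> null_sets ?C" and inj: "inj_on G (space M - Z)"
    and Gs': "\<forall>S. S \<subseteq> space M - Z \<longrightarrow> (S \<in> sets ?C \<longleftrightarrow> G ` S \<in> sets lebesgue)"
    and Ge': "\<forall>S\<in>sets ?C. S \<subseteq> space M - Z \<longrightarrow> emeasure lebesgue (G ` S) = emeasure ?C S"
    and Gim: "G ` (space M - Z) \<subseteq> {0..L}" and Gnull: "{0..L} - G ` (space M - Z) \<in> null_sets lebesgue"
    using lebesgue_space_without_atoms[OF assms] .
  note Gs = Gs'[rule_format] and Ge = Ge'[rule_format]
  have ZC: "Z \<in> sets ?C" and spZ: "space M - Z \<in> sets ?C"
    using null_setsD2[OF Z] sets.compl_sets[of Z ?C] by simp_all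
  have GspZ: "G ` (space M - Z) \<in> sets lebesgue" using Gs[OF order_refl] spZ by simp
  have Gv: "{x\<in>space M - Z. G x \<in> B} \<in> sets ?C" if "B \<in> sets lebesgue" for B
  proof -
    have "G ` {x\<in>space M - Z. G x \<in> B} = B \<inter> G ` (space M - Z)" by blast
    then have "G ` {x\<in>space M - Z. G x \<in> B} \<in> sets lebesgue" using sets.Int[OF that GspZ] by simp
    then show ?thesis by (subst Gs) auto
  qed
  define G0 where "G0 x = (if x \<in> space M - Z then G x else 0)" for x
  have "G0 \<in> borel_measurable ?C"
  proof (rule measurableI)
    fix B :: "real set" assume "B \<in> sets borel"
    then have B: "B \<in> sets lebesgue" by simp
    have "G0 -` B \<inter> space ?C = {x\<in>space M - Z. G x \<in> B} \<union> (if 0 \<in> B then Z \<inter> space M else {})"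
      by (auto simp: G0_def split: if_splits)
    moreover have "Z \<inter> space M \<in> sets ?C" using sets.Int[OF ZC sets.top] by simp
    ultimately show "G0 -` B \<inter> space ?C \<in> sets ?C" using Gv[OF B] by (auto intro: sets.Un)
  qed simp
  then obtain f0 where f0[measurable]: "f0 \<in> borel_measurable M" and f0G: "AE x in M. G0 x = f0 x"
    using completion_ex_borel_measurable_real by blast
  have L0: "0 < L"
  proof (rule ccontr)
    assume "\<not> 0 < L"
    then have "L = 0" using L by simp
    have "emeasure lebesgue (G ` (space M - Z)) \<le> emeasure lebesgue {0..L}"
      using Gim by (intro emeasure_mono) auto
    then have "emeasure ?C (space M - Z) = 0" using Ge[OF spZ order_refl] \<open>L = 0\<close> by simp
    moreover have "emeasure ?C (space M - Z) = emeasure ?C (space M)"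
      using emeasure_Diff_null_set[OF Z sets.top[of ?C]] by simp
    ultimately show False using pos by simp
  qed
  \<comment> \<open>Clipping to the half-open interval changes the function on a null set only.\<close>
  define f where "f x = (if f0 x \<in> {0..<L} then f0 x else 0)" for x
  have fm: "f \<in> borel_measurable M" unfolding f_def[abs_def] by measurable
  have endnull: "{x\<in>space M - Z. G x \<in> {L}} \<in> null_sets ?C"
  proof (rule null_setsI)
    show s: "{x\<in>space M - Z. G x \<in> {L}} \<in> sets ?C" by (rule Gv) simp
    have "emeasure ?C {x\<in>space M - Z. G x \<in> {L}} = emeasure lebesgue (G ` {x\<in>space M - Z. G x \<in> {L}})"
      by (rule Ge[symmetric, OF s]) auto
    also have "\<dots> = 0"
      by (rule emeasure_eq_0[of "{L}"]) auto
    finally show "emeasure ?C {x\<in>space M - Z. G x \<in> {L}} = 0" .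
  qed
  have "AE x in ?C. f x = G x \<and> x \<notin> Z"
    using AE_completion[OF f0G] AE_not_in[OF Z] AE_not_in[OF endnull] AE_space
  proof eventually_elim
    fix x assume x: "G0 x = f0 x" "x \<notin> Z" "x \<notin> {x\<in>space M - Z. G x \<in> {L}}" "x \<in> space ?C"
    then have "x \<in> space M - Z" "G x \<noteq> L" by auto
    moreover from this have "G x \<in> {0..L}" using Gim by blast
    ultimately show "f x = G x \<and> x \<notin> Z" using x(1) by (auto simp: f_def G0_def)
  qed
  then have "AE x in M. f x = G x \<and> x \<notin> Z" by (rule AE_completion_iff[THEN iffD1])
  then obtain N where N: "{x\<in>space M. \<not> (f x = G x \<and> x \<notin> Z)} \<subseteq> N" "N \<in> null_sets M"
    unfolding eventually_ae_filter by blast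
  define X where "X = space M - N"
  have X: "X \<in> sets M" unfolding X_def using null_setsD2[OF N(2)] by (rule sets.compl_sets)
  have XZ: "X \<subseteq> space M - Z" and fG: "\<And>x. x \<in> X \<Longrightarrow> f x = G x" using N(1) by (auto simp: X_def)
  have cX: "space M - X \<in> null_sets M"
  proof -
    have "space M - X = N" using sets.sets_into_space[OF null_setsD2[OF N(2)]] by (auto simp: X_def)
    then show ?thesis using N(2) by simp
  qed
  have fGim: "f ` S = G ` S" if "S \<subseteq> X" for S using fG that by (intro image_cong) auto
  have im: "f ` S \<in> sets lebesgue \<and> emeasure lebesgue (f ` S) = emeasure M S" if S: "S \<in> sets M" "S \<subseteq> X" for S
  proof -
    have SC: "S \<in> sets ?C" and SZ: "S \<subseteq> space M - Z" using S XZ by auto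
    show ?thesis using Gs[OF SZ] Ge[OF SC SZ] SC S(1) by (simp add: fGim[OF S(2)])
  qed
  have conull: "{0..L} - f ` X \<in> null_sets lebesgue"
  proof -
    have NZ: "N - Z \<in> null_sets ?C" "N - Z \<subseteq> space M - Z"
      using sets.sets_into_space[OF null_setsD2[OF N(2)]]
      by (auto intro: null_sets_completion_subset[OF Diff_subset null_sets_completionI[OF N(2)]])
    have "G ` (N - Z) \<in> null_sets lebesgue"
      using Gs[OF NZ(2)] Ge[OF null_setsD2[OF NZ(1)] NZ(2)] null_setsD2[OF NZ(1)] null_setsD1[OF NZ(1)] by (intro null_setsI) simp_all
    then have "({0..L} - G ` (space M - Z)) \<union> G ` (N - Z) \<in> null_sets lebesgue"
      using Gnull by (intro null_sets.Un)
    moreover have "{0..L} - f ` X \<subseteq> ({0..L} - G ` (space M - Z)) \<union> G ` (N - Z)"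
      unfolding fGim[OF order_refl] by (auto simp: X_def)
    ultimately show ?thesis by (rule null_sets_completion_subset[rotated])
  qed
  have "interval_coordinate M f L X"
  proof (intro interval_coordinate.intro fin interval_coordinate_axioms.intro)
    show "f x \<in> {0..<L}" for x using L0 by (simp add: f_def)
    show "inj_on f X" using inj_on_subset[OF inj XZ] fG by (simp add: inj_on_def)
    show "f ` S \<in> sets lebesgue" if "S \<in> sets M" "S \<subseteq> X" for S using im[OF that] by simp
    fix B :: "real set" assume B: "B \<in> sets borel" "B \<subseteq> {0..<L}"
    let ?S = "(f -` B \<inter> space M) \<inter> X"
    have v: "f -` B \<inter> space M \<in> sets M" by (rule measurable_sets[OF fm B(1)])
    have S: "?S \<in> sets M" by (rule sets.Int[OF v X])
    have "emeasure M (f -` B \<inter> space M) = emeasure M ?S"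
    proof (rule emeasure_eq_AE[OF _ v S])
      show "AE x in M. (x \<in> f -` B \<inter> space M) = (x \<in> ?S)"
        using AE_not_in[OF cX] AE_space by eventually_elim auto
    qed
    also have "\<dots> = emeasure lebesgue (f ` ?S)" using im[OF S] by simp
    also have "\<dots> = emeasure lebesgue B"
    proof (rule emeasure_eq_AE)
      show "AE y in lebesgue. (y \<in> f ` ?S) = (y \<in> B)"
        using AE_not_in[OF conull]
      proof eventually_elim
        fix y assume y: "y \<notin> {0..L} - f ` X"
        have "y \<in> f ` ?S" if "y \<in> B"
        proof -
          have "y \<in> {0..<L}" using that B(2) by blast
          then obtain x where "x \<in> X" "y = f x" using y by auto
          then show ?thesis using that sets.sets_into_space[OF X] by blast
        qed
        then show "(y \<in> f ` ?S) = (y \<in> B)" by blast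
      qed
    qed (use im[OF S] B in simp_all)
    also have "\<dots> = emeasure lborel B" using B by simp
    finally show "emeasure M (f -` B \<inter> space M) = emeasure lborel B" .
  qed (fact L0 fm X cX)+
  then show ?thesis by (rule that)
qed

section \<open>Estimates for polymorphisms\<close>

locale polymorphism = finite_measure M for M :: "'a measure" +
  fixes Q :: "('a \<times> 'a \<times> real) measure"
  assumes in_pol: "Q \<in> pol M"
begin

lemma sets_Q: "sets Q = sets (pol_space M)"
  using in_pol by (simp add: pol_def)

lemma space_Q: "space Q = space M \<times> space M \<times> {0<..}"
  using sets_eq_imp_space_eq[OF sets_Q] by (simp add: space_pair_measure space_restrict_space)

lemma Q_measurable: "measurable Q N = measurable (pol_space M) N"
  by (rule measurable_cong_sets[OF sets_Q refl])

lemma first_measurable [measurable]: "(\<lambda>x. fst x) \<in> measurable Q M"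
  unfolding Q_measurable by (rule measurable_fst)

lemma second_measurable [measurable]: "(\<lambda>x. fst (snd x)) \<in> measurable Q M"
  unfolding Q_measurable by (rule measurable_compose[OF measurable_snd measurable_fst])

lemma third_measurable [measurable]: "(\<lambda>x. snd (snd x)) \<in> measurable Q pos_reals"
  unfolding Q_measurable by (rule measurable_compose[OF measurable_snd measurable_snd])

lemma weight_measurable [measurable]: "(\<lambda>x. snd (snd x)) \<in> borel_measurable Q"
  by (rule measurable_compose[OF third_measurable]) (simp add: measurable_restrict_space1)

lemma nn_integral_first:
  assumes "S \<in> sets M"
  shows "(\<integral>\<^sup>+x. indicator S (fst x) \<partial>Q) = emeasure M S"
proof -
  have d: "distr Q M (\<lambda>x. fst x) = M"
    using in_pol by (simp add: pol_def split_beta')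
  have "emeasure M S = (\<integral>\<^sup>+a. indicator S a \<partial>distr Q M (\<lambda>x. fst x))"
    unfolding d using assms by simp
  also have "\<dots> = (\<integral>\<^sup>+x. indicator S (fst x) \<partial>Q)"
    using assms by (subst nn_integral_distr[OF first_measurable]) simp_all
  finally show ?thesis by simp
qed

lemma nn_integral_second:
  assumes "T \<in> sets M"
  shows "(\<integral>\<^sup>+x. ennreal (snd (snd x)) * indicator T (fst (snd x)) \<partial>Q) = emeasure M T"
proof -
  have "emeasure M T = emeasure (distr (density Q (\<lambda>(a, b, t). ennreal t)) M (\<lambda>(a, b, t). b)) T"
    using in_pol by (simp only: pol_def mem_Collect_eq)
  also have "\<dots> = (\<integral>\<^sup>+(a, b, t). ennreal t * indicator T b \<partial>Q)"
    by (rule emeasure_distr_density_second[OF sets_Q assms])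
  finally show ?thesis by (simp add: split_beta')
qed

lemma finite_Q: "finite_measure Q"
proof (rule finite_measureI)
  have "emeasure Q (space Q) = (\<integral>\<^sup>+x. indicator (space M) (fst x) \<partial>Q)"
    by (subst nn_integral_indicator[symmetric], simp, intro nn_integral_cong)
       (auto simp: space_Q indicator_def)
  then show "emeasure Q (space Q) \<noteq> \<infinity>" by (simp add: nn_integral_first)
qed

lemma weight_pos: "x \<in> space Q \<Longrightarrow> 0 < snd (snd x)"
  by (auto simp: space_Q)

lemma weight_integrable: "integrable Q (\<lambda>x. snd (snd x))"
proof (rule integrableI_nonneg)
  show "AE x in Q. 0 \<le> snd (snd x)" using weight_pos by (auto intro!: AE_I2 less_imp_le)
  have "(\<integral>\<^sup>+x. ennreal (snd (snd x)) \<partial>Q) = (\<integral>\<^sup>+x. ennreal (snd (snd x)) * indicator (space M) (fst (snd x)) \<partial>Q)"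
    by (intro nn_integral_cong) (auto simp: space_Q indicator_def)
  also have "\<dots> = emeasure M (space M)" by (rule nn_integral_second) simp
  finally show "(\<integral>\<^sup>+x. ennreal (snd (snd x)) \<partial>Q) < \<infinity>" by (simp add: less_top[symmetric])
qed (rule weight_measurable)

lemma one_plus_weight_integrable: "integrable Q (\<lambda>x. 1 + snd (snd x))"
  by (intro Bochner_Integration.integrable_add finite_measure.integrable_const[OF finite_Q] weight_integrable)

lemma integrable_if_linear_bound:
  assumes "f \<in> borel_measurable Q" and "\<And>x. x \<in> space Q \<Longrightarrow> \<bar>f x\<bar> \<le> C * (1 + snd (snd x))"
  shows "integrable Q (f :: _ \<Rightarrow> real)"
proof (rule Bochner_Integration.integrable_bound[OF integrable_mult_right[OF one_plus_weight_integrable, of C] assms(1)])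
  show "AE x in Q. norm (f x) \<le> norm (C * (1 + snd (snd x)))"
    using assms(2) by (intro AE_I2) force
qed

lemma integral_first:
  assumes [measurable]: "S \<in> sets M"
  shows "(\<integral>x. indicator S (fst x) \<partial>Q) = measure M S"
  using nn_integral_first[OF assms]
  by (subst integral_eq_nn_integral) (simp_all add: ennreal_indicator measure_def)

lemma integral_second:
  assumes [measurable]: "T \<in> sets M"
  shows "(\<integral>x. snd (snd x) * indicator T (fst (snd x)) \<partial>Q) = measure M T"
proof -
  have "(\<integral>\<^sup>+x. ennreal (snd (snd x) * indicator T (fst (snd x))) \<partial>Q) = emeasure M T"
    unfolding nn_integral_second[OF assms, symmetric]
    by (intro nn_integral_cong) (auto simp: indicator_def)
  moreover have "AE x in Q. 0 \<le> snd (snd x) * indicator T (fst (snd x))"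
    using weight_pos by (intro AE_I2) (simp add: indicator_def less_imp_le)
  ultimately show ?thesis
    by (subst integral_eq_nn_integral) (simp_all add: measure_def)
qed

lemma rectangle_sets:
  assumes "S \<in> sets M" "T \<in> sets M" "E \<in> sets pos_reals"
  shows "S \<times> T \<times> E \<in> sets Q"
  unfolding sets_Q using assms by (intro pair_measureI)

lemma pos_reals_top: "{0<..} \<in> sets pos_reals"
  by (simp add: sets_pos_reals)

lemma block_map_measurable:
  "(\<lambda>(a, b, t). t) \<in> measurable (restrict_space Q (S \<times> T \<times> {0<..})) pos_reals"
  using measurable_restrict_space1[OF third_measurable] by (simp add: split_beta')

lemma emeasure_pol_block:
  assumes S: "S \<in> sets M" and T: "T \<in> sets M" and E: "E \<in> sets pos_reals"
  shows "emeasure (pol_block Q S T) E = emeasure Q (S \<times> T \<times> E)"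
proof -
  let ?R = "restrict_space Q (S \<times> T \<times> {0<..})"
  have Ep: "E \<subseteq> {0<..}" using E by (simp add: sets_pos_reals)
  have ST: "S \<subseteq> space M" "T \<subseteq> space M" using S T sets.sets_into_space by auto
  have "emeasure (pol_block Q S T) E = emeasure ?R ((\<lambda>(a, b, t). t) -` E \<inter> space ?R)"
    unfolding pol_block_def by (rule emeasure_distr[OF block_map_measurable E])
  also have "(\<lambda>(a, b, t). t) -` E \<inter> space ?R = S \<times> T \<times> E"
    using Ep ST by (auto simp: space_restrict_space space_Q)
  also have "emeasure ?R (S \<times> T \<times> E) = emeasure Q (S \<times> T \<times> E)"
    using rectangle_sets[OF S T pos_reals_top] Ep
    by (intro emeasure_restrict_space) auto
  finally show ?thesis .
qed

lemma nn_integral_pol_block: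
  assumes S: "S \<in> sets M" and T: "T \<in> sets M" and F: "F \<in> borel_measurable pos_reals"
  shows "(\<integral>\<^sup>+t. F t \<partial>pol_block Q S T) = (\<integral>\<^sup>+x. F (snd (snd x)) * (indicator S (fst x) * indicator T (fst (snd x))) \<partial>Q)"
proof -
  let ?R = "restrict_space Q (S \<times> T \<times> {0<..})"
  have "(\<integral>\<^sup>+t. F t \<partial>pol_block Q S T) = (\<integral>\<^sup>+x. F (snd (snd x)) \<partial>?R)"
    unfolding pol_block_def using F
    by (subst nn_integral_distr[OF block_map_measurable]) (simp_all add: split_beta')
  also have "\<dots> = (\<integral>\<^sup>+x\<in>S \<times> T \<times> {0<..}. F (snd (snd x)) \<partial>Q)"
    using rectangle_sets[OF S T pos_reals_top] by (intro nn_integral_restrict_space) auto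
  also have "\<dots> = (\<integral>\<^sup>+x. F (snd (snd x)) * (indicator S (fst x) * indicator T (fst (snd x))) \<partial>Q)"
    by (intro nn_integral_cong) (auto simp: space_Q indicator_def)
  finally show ?thesis .
qed

lemma integral_pol_block:
  fixes F :: "real \<Rightarrow> real"
  assumes S: "S \<in> sets M" and T: "T \<in> sets M" and F: "F \<in> borel_measurable pos_reals"
  shows "(\<integral>t. F t \<partial>pol_block Q S T) = (\<integral>x. F (snd (snd x)) * (indicator S (fst x) * indicator T (fst (snd x))) \<partial>Q)"
proof -
  let ?R = "restrict_space Q (S \<times> T \<times> {0<..})"
  have "(\<integral>t. F t \<partial>pol_block Q S T) = (\<integral>x. F (snd (snd x)) \<partial>?R)"
    unfolding pol_block_def using F
    by (subst integral_distr[OF block_map_measurable]) (simp_all add: split_beta')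
  also have "\<dots> = (\<integral>x. indicator (S \<times> T \<times> {0<..}) x *\<^sub>R F (snd (snd x)) \<partial>Q)"
    using rectangle_sets[OF S T pos_reals_top] by (intro integral_restrict_space) auto
  also have "\<dots> = (\<integral>x. F (snd (snd x)) * (indicator S (fst x) * indicator T (fst (snd x))) \<partial>Q)"
    by (intro Bochner_Integration.integral_cong) (auto simp: space_Q indicator_def)
  finally show ?thesis .
qed

lemma sets_pol_block: "sets (pol_block Q S T) = sets pos_reals"
  by (simp add: pol_block_def)

text \<open>Both finiteness conditions come from the marginals: the mass is bounded by that of the first
marginal, the mean by that of the weighted second marginal.\<close>

lemma pol_block_in_M_nabla:
  assumes S: "S \<in> sets M" and T: "T \<in> sets M"
  shows "pol_block Q S T \<in> M_nabla"
proof -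
  have sp: "space (pol_block Q S T) = {0<..}"
    using sets_eq_imp_space_eq[OF sets_pol_block] by (simp add: space_restrict_space)
  have "emeasure (pol_block Q S T) {0<..} \<le> emeasure Q (space Q)"
    unfolding emeasure_pol_block[OF S T pos_reals_top] by (rule emeasure_space)
  also have "\<dots> < \<infinity>" using finite_measure.emeasure_finite[OF finite_Q] by (simp add: less_top[symmetric])
  finally have 1: "emeasure (pol_block Q S T) (space (pol_block Q S T)) < \<infinity>" by (simp add: sp)
  have "(\<integral>\<^sup>+t. ennreal t \<partial>pol_block Q S T) \<le> (\<integral>\<^sup>+x. ennreal (snd (snd x)) * indicator T (fst (snd x)) \<partial>Q)"
    unfolding nn_integral_pol_block[OF S T pos_reals_ennreal_measurable]
    by (intro nn_integral_mono) (auto simp: indicator_def)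
  also have "\<dots> = emeasure M T" by (rule nn_integral_second[OF T])
  also have "\<dots> < \<infinity>" by (simp add: less_top[symmetric])
  finally show ?thesis using 1 by (simp add: M_nabla_def sets_pol_block)
qed

text \<open>The first marginal does not see how much of \<open>\<integral> t dQ\<close> comes from large \<open>t\<close>, and the second does not see
how much of the mass comes from small \<open>t\<close>. This quantity measures both.\<close>

definition tail :: "real \<Rightarrow> real" where
  "tail K = (\<integral>x. (1 + snd (snd x)) * indicator ({..<1 / K} \<union> {K<..}) (snd (snd x)) \<partial>Q)"

lemma tail_eq_block:
  "tail K = (\<integral>t. (1 + t) * indicator ({..<1 / K} \<union> {K<..}) t \<partial>pol_block Q (space M) (space M))"
proof -
  have m: "(\<lambda>t. (1 + t) * indicator ({..<1 / K} \<union> {K<..}) t :: real) \<in> borel_measurable pos_reals"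
    by (rule measurable_restrict_space1) measurable
  show ?thesis unfolding tail_def integral_pol_block[OF sets.top sets.top m]
    by (intro Bochner_Integration.integral_cong) (auto simp: space_Q)
qed

lemma tail_tendsto_0: "(\<lambda>k. tail (real (Suc k))) \<longlonglongrightarrow> 0"
proof -
  have "(\<lambda>k. tail (real (Suc k))) \<longlonglongrightarrow> (\<integral>x. 0 \<partial>Q)"
    unfolding tail_def
  proof (rule integral_dominated_convergence[OF _ _ one_plus_weight_integrable])
    show "AE x in Q. (\<lambda>k. (1 + snd (snd x)) * indicator ({..<1 / real (Suc k)} \<union> {real (Suc k)<..}) (snd (snd x))) \<longlonglongrightarrow> 0"
    proof (rule AE_I2)
      fix x assume "x \<in> space Q"
      then have t: "0 < snd (snd x)" (is "0 < ?t") by (rule weight_pos)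
      obtain k0 where k0: "max ?t (1 / ?t) < real k0" using reals_Archimedean2 by blast
      have "(1 + ?t) * indicator ({..<1 / real (Suc k)} \<union> {real (Suc k)<..}) ?t = 0" if "k0 \<le> k" for k
      proof -
        have "?t < real (Suc k)" "1 / ?t < real (Suc k)" using k0 that by auto
        then have "\<not> ?t < 1 / real (Suc k)" using t by (simp add: field_simps del: of_nat_Suc)
        then show ?thesis using \<open>?t < real (Suc k)\<close> by simp
      qed
      then show "(\<lambda>k. (1 + ?t) * indicator ({..<1 / real (Suc k)} \<union> {real (Suc k)<..}) ?t) \<longlonglongrightarrow> 0"
        by (intro tendsto_eventually eventually_sequentiallyI[of k0]) simp
    qed
    show "AE x in Q. norm ((1 + snd (snd x)) * indicator ({..<1 / real (Suc k)} \<union> {real (Suc k)<..}) (snd (snd x))) \<le> 1 + snd (snd x)" for k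
      using weight_pos by (intro AE_I2) (auto simp: indicator_def less_imp_le abs_mult)
  qed measurable
  then show ?thesis by simp
qed

text \<open>The estimate behind the density theorem. Changing \<open>S\<close> on a small set \<open>E\<close> changes \<open>\<integral> F\<close> by at most the
integral of \<open>1 + t\<close> over \<open>E\<close> in the first factor. The first marginal controls the integral of 1
there, but not that of \<open>t\<close>; the second marginal controls the integral of \<open>t\<close> over a small set in the
second factor, but not that of 1. Where \<open>1/K \<le> t \<le> K\<close> the two are comparable up to the factor \<open>1 + K\<close>,
and the rest is absorbed by the tail. The bound depends on \<open>Q\<close> only through its tail, that is, through
the law of \<open>t\<close>.\<close>

lemma block_integral_perturbation:
  assumes [measurable]: "S \<in> sets M" "S' \<in> sets M" "T \<in> sets M" "T' \<in> sets M"
    and F[measurable]: "F \<in> borel_measurable pos_reals" and bound: "\<And>t. 0 < t \<Longrightarrow> \<bar>F t\<bar> \<le> C * (1 + t)"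
    and K: "0 < K" and C: "0 \<le> C"
  shows "\<bar>(\<integral>t. F t \<partial>pol_block Q S T) - (\<integral>t. F t \<partial>pol_block Q S' T')\<bar>
    \<le> C * ((1 + K) * (measure M (sym_diff S S') + measure M (sym_diff T T')) + 2 * tail K)"
proof -
  let ?A = "sym_diff S S'" and ?B = "sym_diff T T'"
  let ?I = "\<lambda>S T x. indicator S (fst x) * indicator T (fst (snd x)) :: real"
  let ?F = "\<lambda>x. F (snd (snd x))"
  let ?tl = "\<lambda>x. (1 + snd (snd x)) * indicator ({..<1 / K} \<union> {K<..}) (snd (snd x)) :: real"
  have Fx: "\<bar>?F x\<bar> \<le> C * (1 + snd (snd x))" if "x \<in> space Q" for x
    using bound weight_pos[OF that] by simp
  have int: "integrable Q (\<lambda>x. ?F x * ?I S T x)" if [measurable]: "S \<in> sets M" "T \<in> sets M" for S T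
  proof (rule integrable_if_linear_bound)
    show "\<bar>?F x * ?I S T x\<bar> \<le> C * (1 + snd (snd x))" if "x \<in> space Q" for x
      using Fx[OF that] C weight_pos[OF that] by (auto simp: indicator_def)
  qed measurable
  have mi1: "(\<lambda>x. indicator ?A (fst x) :: real) \<in> borel_measurable Q" by measurable
  have i1: "integrable Q (\<lambda>x. indicator ?A (fst x) :: real)"
    by (rule integrable_if_linear_bound[OF mi1, of 1]) (use weight_pos in \<open>simp add: indicator_def less_imp_le abs_mult\<close>)
  have mi2: "(\<lambda>x. snd (snd x) * indicator ?B (fst (snd x)) :: real) \<in> borel_measurable Q" by measurable
  have i2: "integrable Q (\<lambda>x. snd (snd x) * indicator ?B (fst (snd x)) :: real)"
    by (rule integrable_if_linear_bound[OF mi2, of 1]) (use weight_pos in \<open>simp add: indicator_def less_imp_le abs_mult\<close>)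
  have mi3: "?tl \<in> borel_measurable Q" by measurable
  have i3: "integrable Q ?tl"
    by (rule integrable_if_linear_bound[OF mi3, of 1]) (use weight_pos in \<open>simp add: indicator_def less_imp_le abs_mult\<close>)
  let ?g = "\<lambda>x. C * ((1 + K) * (indicator ?A (fst x) + snd (snd x) * indicator ?B (fst (snd x))) + 2 * ?tl x)"
  have ig: "integrable Q ?g"
    by (intro integrable_mult_right Bochner_Integration.integrable_add i1 i2 i3)
  have "\<bar>(\<integral>t. F t \<partial>pol_block Q S T) - (\<integral>t. F t \<partial>pol_block Q S' T')\<bar>
      = \<bar>\<integral>x. ?F x * ?I S T x - ?F x * ?I S' T' x \<partial>Q\<bar>"
    by (simp add: integral_pol_block Bochner_Integration.integral_diff int)
  also have "\<dots> \<le> (\<integral>x. \<bar>?F x * ?I S T x - ?F x * ?I S' T' x\<bar> \<partial>Q)"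
    by (rule integral_abs_bound)
  also have "\<dots> \<le> (\<integral>x. ?g x \<partial>Q)"
  proof (rule integral_mono[OF _ ig])
    show "integrable Q (\<lambda>x. \<bar>?F x * ?I S T x - ?F x * ?I S' T' x\<bar>)"
      by (intro integrable_abs Bochner_Integration.integrable_diff int) measurable
    fix x assume x: "x \<in> space Q"
    let ?t = "snd (snd x)"
    have t: "0 < ?t" by (rule weight_pos[OF x])
    have "\<bar>?I S T x - ?I S' T' x\<bar> \<le> indicator ?A (fst x) + indicator ?B (fst (snd x))"
      by (auto simp: indicator_def)
    then have "\<bar>?F x\<bar> * \<bar>?I S T x - ?I S' T' x\<bar> \<le> (C * (1 + ?t)) * (indicator ?A (fst x) + indicator ?B (fst (snd x)))"
      using Fx[OF x] C t by (intro mult_mono) auto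
    then have 1: "\<bar>?F x * ?I S T x - ?F x * ?I S' T' x\<bar> \<le> C * ((1 + ?t) * (indicator ?A (fst x) + indicator ?B (fst (snd x))))"
      by (simp only: right_diff_distrib[symmetric] abs_mult mult.assoc)
    \<comment> \<open>In the first factor only large t has to be cut off.\<close>
    have 2: "(1 + ?t) * indicator ?A (fst x) \<le> (1 + K) * indicator ?A (fst x) + ?tl x"
      using t K by (auto simp: indicator_def)
    \<comment> \<open>In the second factor only small t has to be cut off.\<close>
    have "1 + ?t \<le> (1 + K) * ?t" if "\<not> ?t < 1 / K"
      using that K by (simp add: field_simps)
    then have 3: "(1 + ?t) * indicator ?B (fst (snd x)) \<le> (1 + K) * (?t * indicator ?B (fst (snd x))) + ?tl x"
      using t K by (auto simp: indicator_def)
    have "(1 + ?t) * (indicator ?A (fst x) + indicator ?B (fst (snd x))) \<le>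
        (1 + K) * (indicator ?A (fst x) + ?t * indicator ?B (fst (snd x))) + 2 * ?tl x"
      using 2 3 by (simp only: distrib_left)
    from 1 order_trans[OF 1 mult_left_mono[OF this C]]
    show "\<bar>?F x * ?I S T x - ?F x * ?I S' T' x\<bar> \<le> ?g x" by simp
  qed
  also have "\<dots> = C * ((1 + K) * (measure M ?A + measure M ?B) + 2 * tail K)"
    unfolding tail_def using i1 i2 i3 integral_first[of ?A] integral_second[of ?B] by simp
  finally show ?thesis .
qed

end

section \<open>Convergence from agreement of blocks\<close>

text \<open>Replace \<open>S\<close> and \<open>T\<close> by nearby sets of \<open>\<A> n\<close>, where the blocks of \<open>Qs n\<close> and \<open>P\<close> coincide. The two errors
are bounded by the perturbation estimate uniformly in \<open>n\<close>: since the whole space belongs to \<open>\<A> n\<close>, all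
\<open>Qs n\<close> have the same law of \<open>t\<close> as \<open>P\<close>, hence the same tails.\<close>

lemma block_integrals_converge:
  fixes Qs :: "nat \<Rightarrow> ('a \<times> 'a \<times> real) measure"
  assumes fin: "finite_measure M" and P: "P \<in> pol M" and Qs: "\<And>n. Qs n \<in> pol M"
    and \<A>: "\<And>n. \<A> n \<subseteq> sets M" "\<And>n. space M \<in> \<A> n"
    and approx: "\<And>S \<epsilon>. S \<in> sets M \<Longrightarrow> 0 < \<epsilon> \<Longrightarrow> \<forall>\<^sub>F n in sequentially. \<exists>S'\<in>\<A> n. measure M (sym_diff S S') < \<epsilon>"
    and agree: "\<And>n S T. S \<in> \<A> n \<Longrightarrow> T \<in> \<A> n \<Longrightarrow> pol_block (Qs n) S T = pol_block P S T"
    and S: "S \<in> sets M" and T: "T \<in> sets M"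
    and F: "F \<in> borel_measurable pos_reals" and bound: "\<And>t. 0 < t \<Longrightarrow> \<bar>F t\<bar> \<le> C * (1 + t)"
  shows "(\<lambda>n. \<integral>t. F t \<partial>pol_block (Qs n) S T) \<longlonglongrightarrow> (\<integral>t. F t \<partial>pol_block P S T)"
proof (rule LIMSEQ_I)
  interpret P: polymorphism M P using fin P by (intro polymorphism.intro polymorphism_axioms.intro)
  have Q: "polymorphism M (Qs n)" for n using fin Qs by (intro polymorphism.intro polymorphism_axioms.intro)
  have C: "0 \<le> C" using bound[of 1] by simp
  fix \<epsilon> :: real assume \<epsilon>: "0 < \<epsilon>"
  \<comment> \<open>Each of the two errors is at most C times (2 \<eta> + 2 \<eta>), so the total stays below \<epsilon>.\<close>
  define \<eta> where "\<eta> = \<epsilon> / (8 * (C + 1))"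
  have \<eta>: "0 < \<eta>" "8 * (C * \<eta>) \<le> \<epsilon>" using \<epsilon> C by (auto simp: \<eta>_def field_simps)
  have C\<eta>: "0 \<le> C * \<eta>" "C * \<eta> < \<epsilon> / 8" using C \<eta>(1) \<epsilon> by (auto simp: \<eta>_def field_simps)
  have "\<forall>\<^sub>F k in sequentially. P.tail (real (Suc k)) < \<eta>"
    using order_tendstoD(2)[OF P.tail_tendsto_0 \<eta>(1)] .
  then obtain k where k: "P.tail (real (Suc k)) < \<eta>" unfolding eventually_sequentially by blast
  define K where "K = real (Suc k)"
  have K: "0 < K" "P.tail K < \<eta>" using k by (auto simp: K_def)
  define \<delta> where "\<delta> = \<eta> / (1 + K)"
  have \<delta>: "0 < \<delta>" "(1 + K) * \<delta> = \<eta>" using \<eta> K by (auto simp: \<delta>_def field_simps)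
  have "\<forall>\<^sub>F n in sequentially. norm ((\<integral>t. F t \<partial>pol_block (Qs n) S T) - (\<integral>t. F t \<partial>pol_block P S T)) < \<epsilon>"
    using approx[OF S \<delta>(1)] approx[OF T \<delta>(1)]
  proof eventually_elim
    fix n assume "\<exists>S'\<in>\<A> n. measure M (sym_diff S S') < \<delta>" "\<exists>T'\<in>\<A> n. measure M (sym_diff T T') < \<delta>"
    then obtain S' T' where S': "S' \<in> \<A> n" "measure M (sym_diff S S') < \<delta>"
      and T': "T' \<in> \<A> n" "measure M (sym_diff T T') < \<delta>" by blast
    have s: "S' \<in> sets M" "T' \<in> sets M" using S'(1) T'(1) \<A>(1) by blast+
    let ?e = "C * ((1 + K) * (measure M (sym_diff S S') + measure M (sym_diff T T')) + 2 * P.tail K)"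
    have tl: "polymorphism.tail (Qs n) K = P.tail K"
      unfolding polymorphism.tail_eq_block[OF Q] P.tail_eq_block agree[OF \<A>(2) \<A>(2)] ..
    have "\<bar>(\<integral>t. F t \<partial>pol_block (Qs n) S T) - (\<integral>t. F t \<partial>pol_block (Qs n) S' T')\<bar> \<le> ?e"
      using polymorphism.block_integral_perturbation[OF Q S s(1) T s(2) F bound K(1) C, of n] unfolding tl .
    moreover have "\<bar>(\<integral>t. F t \<partial>pol_block P S T) - (\<integral>t. F t \<partial>pol_block P S' T')\<bar> \<le> ?e"
      by (rule P.block_integral_perturbation[OF S s(1) T s(2) F bound K(1) C])
    moreover have "?e \<le> C * (4 * \<eta>)"
    proof (rule mult_left_mono[OF _ C])
      have "(1 + K) * (measure M (sym_diff S S') + measure M (sym_diff T T')) \<le> (1 + K) * (\<delta> + \<delta>)"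
        using S'(2) T'(2) K(1) by (intro mult_left_mono) auto
      then show "(1 + K) * (measure M (sym_diff S S') + measure M (sym_diff T T')) + 2 * P.tail K \<le> 4 * \<eta>"
        using \<delta>(2) K(2) by (simp add: distrib_left)
    qed
    ultimately show "norm ((\<integral>t. F t \<partial>pol_block (Qs n) S T) - (\<integral>t. F t \<partial>pol_block P S T)) < \<epsilon>"
      using C\<eta> agree[OF S'(1) T'(1)] by simp
  qed
  then show "\<exists>no. \<forall>n\<ge>no. norm ((\<integral>t. F t \<partial>pol_block (Qs n) S T) - (\<integral>t. F t \<partial>pol_block P S T)) < \<epsilon>"
    unfolding eventually_sequentially .
qed

text \<open>Both weak convergences are instances of the convergence of integrals of functions of at most linear
growth: bounded functions \<open>f\<close>, and \<open>t f(t)\<close> for the measures weighted by \<open>t\<close>.\<close>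

lemma pol_conv_by_block_agreement:
  fixes Qs :: "nat \<Rightarrow> ('a \<times> 'a \<times> real) measure"
  assumes fin: "finite_measure M" and P: "P \<in> pol M" and Qs: "\<And>n. Qs n \<in> pol M"
    and \<A>: "\<And>n. \<A> n \<subseteq> sets M" "\<And>n. space M \<in> \<A> n"
    and approx: "\<And>S \<epsilon>. S \<in> sets M \<Longrightarrow> 0 < \<epsilon> \<Longrightarrow> \<forall>\<^sub>F n in sequentially. \<exists>S'\<in>\<A> n. measure M (sym_diff S S') < \<epsilon>"
    and agree: "\<And>n S T. S \<in> \<A> n \<Longrightarrow> T \<in> \<A> n \<Longrightarrow> pol_block (Qs n) S T = pol_block P S T"
  shows "pol_conv M Qs P"
  unfolding pol_conv_def M_nabla_conv_def
proof (intro ballI conjI allI)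
  fix S T assume S: "S \<in> sets M" and T: "T \<in> sets M"
  have pol: "polymorphism M Q" if "Q \<in> pol M" for Q
    using fin that by (intro polymorphism.intro polymorphism_axioms.intro)
  show "pol_block (Qs n) S T \<in> M_nabla" for n
    by (rule polymorphism.pol_block_in_M_nabla[OF pol[OF Qs] S T])
  show "pol_block P S T \<in> M_nabla"
    by (rule polymorphism.pol_block_in_M_nabla[OF pol[OF P] S T])
  note conv = block_integrals_converge[OF fin P Qs \<A> approx agree S T]
  have fb: "f \<in> borel_measurable pos_reals \<and> (\<exists>C\<ge>0. \<forall>t>0. \<bar>f t\<bar> \<le> C)"
    if cb: "continuous_on {0<..} f \<and> bounded (f ` {0<..})" for f :: "real \<Rightarrow> real"
  proof
    show "f \<in> borel_measurable pos_reals"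
      using that by (intro borel_measurable_continuous_on_restrict) simp
    obtain B where B: "\<forall>x\<in>f ` {0<..}. norm x \<le> B" using cb unfolding bounded_iff by blast
    have "\<bar>f t\<bar> \<le> \<bar>B\<bar>" if "0 < t" for t
      using bspec[OF B imageI[of t "{0<..}" f]] that by simp
    then show "\<exists>C\<ge>0. \<forall>t>0. \<bar>f t\<bar> \<le> C" by (intro exI[of _ "\<bar>B\<bar>"]) simp
  qed
  show "weak_conv_pos (\<lambda>n. pol_block (Qs n) S T) (pol_block P S T)"
    unfolding weak_conv_pos_def
  proof (intro allI impI)
    fix f :: "real \<Rightarrow> real" assume f: "continuous_on {0<..} f \<and> bounded (f ` {0<..})"
    obtain C where C: "0 \<le> C" "\<forall>t>0. \<bar>f t\<bar> \<le> C" using fb[OF f] by blast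
    show "(\<lambda>n. \<integral>t. f t \<partial>pol_block (Qs n) S T) \<longlonglongrightarrow> (\<integral>t. f t \<partial>pol_block P S T)"
    proof (rule conv)
      show "f \<in> borel_measurable pos_reals" using fb[OF f] by blast
      show "\<bar>f t\<bar> \<le> C * (1 + t)" if "0 < t" for t
      proof -
        have "\<bar>f t\<bar> \<le> C" using C(2) that by blast
        also have "\<dots> \<le> C * (1 + t)" using C(1) that by (simp add: distrib_left)
        finally show ?thesis .
      qed
    qed
  qed
  show "weak_conv_pos (\<lambda>n. density (pol_block (Qs n) S T) ennreal) (density (pol_block P S T) ennreal)"
    unfolding weak_conv_pos_def
  proof (intro allI impI)
    fix f :: "real \<Rightarrow> real" assume f: "continuous_on {0<..} f \<and> bounded (f ` {0<..})"
    obtain C where C: "0 \<le> C" "\<forall>t>0. \<bar>f t\<bar> \<le> C" using fb[OF f] by blast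
    have fm: "f \<in> borel_measurable pos_reals" using fb[OF f] by blast
    have idm: "(\<lambda>t. t) \<in> borel_measurable pos_reals" by (rule measurable_restrict_space1) simp
    have d: "(\<integral>t. f t \<partial>density (pol_block Q S T) ennreal) = (\<integral>t. t * f t \<partial>pol_block Q S T)"
      if "Q \<in> pol M" for Q
    proof -
      have s: "sets (pol_block Q S T) = sets pos_reals" by (simp add: pol_block_def)
      have "AE t in pol_block Q S T. 0 \<le> t"
        using sets_eq_imp_space_eq[OF s] by (intro AE_I2) (simp add: space_restrict_space)
      moreover have "f \<in> borel_measurable (pol_block Q S T)" "(\<lambda>t. t) \<in> borel_measurable (pol_block Q S T)"
        using fm idm by (simp_all only: measurable_cong_sets[OF s refl])
      ultimately have "(\<integral>t. f t \<partial>density (pol_block Q S T) (\<lambda>t. ennreal t)) = (\<integral>t. t *\<^sub>R f t \<partial>pol_block Q S T)"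
        by (intro integral_density)
      then show ?thesis by simp
    qed
    show "(\<lambda>n. \<integral>t. f t \<partial>density (pol_block (Qs n) S T) ennreal) \<longlonglongrightarrow> (\<integral>t. f t \<partial>density (pol_block P S T) ennreal)"
      unfolding d[OF P] d[OF Qs]
    proof (rule conv)
      show "(\<lambda>t. t * f t) \<in> borel_measurable pos_reals" using fm idm by (intro borel_measurable_times)
      show "\<bar>t * f t\<bar> \<le> C * (1 + t)" if "0 < t" for t
      proof -
        have "\<bar>t * f t\<bar> \<le> t * C" using C(2) that by (simp add: abs_mult)
        also have "\<dots> \<le> C * (1 + t)" using C(1) by (simp add: distrib_left mult.commute)
        finally show ?thesis .
      qed
    qed
  qed
qed

text \<open>Blocks are finitely additive in both arguments.\<close>

lemma pol_block_eq_on_unions: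
  assumes fin: "finite_measure M" and P: "P \<in> pol M" and Q: "Q \<in> pol M"
    and A: "\<And>i. A i \<in> sets M" "disjoint_family A"
    and agree: "\<And>i j. i \<in> I \<Longrightarrow> j \<in> J \<Longrightarrow> pol_block Q (A i) (A j) = pol_block P (A i) (A j)"
    and fin_IJ: "finite I" "finite J"
  shows "pol_block Q (\<Union>i\<in>I. A i) (\<Union>j\<in>J. A j) = pol_block P (\<Union>i\<in>I. A i) (\<Union>j\<in>J. A j)"
proof (rule measure_eqI)
  have U: "(\<Union>i\<in>I. A i) \<in> sets M" "(\<Union>j\<in>J. A j) \<in> sets M" using A(1) fin_IJ by (auto intro: sets.finite_UN)
  have sum: "emeasure (pol_block R (\<Union>i\<in>I. A i) (\<Union>j\<in>J. A j)) E = (\<Sum>(i, j)\<in>I \<times> J. emeasure (pol_block R (A i) (A j)) E)"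
    if R: "R \<in> pol M" and E: "E \<in> sets pos_reals" for R E
  proof -
    interpret R: polymorphism M R using fin R by (intro polymorphism.intro polymorphism_axioms.intro)
    have "emeasure (pol_block R (\<Union>i\<in>I. A i) (\<Union>j\<in>J. A j)) E = emeasure R (\<Union>(i, j)\<in>I \<times> J. A i \<times> A j \<times> E)"
      unfolding R.emeasure_pol_block[OF U E] by (intro arg_cong[where f="emeasure R"]) auto
    also have "\<dots> = (\<Sum>k\<in>I \<times> J. emeasure R (case k of (i, j) \<Rightarrow> A i \<times> A j \<times> E))"
    proof (rule sum_emeasure[symmetric])
      show "(\<lambda>(i, j). A i \<times> A j \<times> E) ` (I \<times> J) \<subseteq> sets R"
        using R.rectangle_sets[OF A(1) A(1) E] by auto
      show "disjoint_family_on (\<lambda>(i, j). A i \<times> A j \<times> E) (I \<times> J)"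
        using A(2) unfolding disjoint_family_on_def by fastforce
    qed (use fin_IJ in simp)
    also have "\<dots> = (\<Sum>(i, j)\<in>I \<times> J. emeasure (pol_block R (A i) (A j)) E)"
      by (intro sum.cong) (auto simp: R.emeasure_pol_block[OF A(1) A(1) E])
    finally show ?thesis .
  qed
  fix E assume "E \<in> sets (pol_block Q (\<Union>i\<in>I. A i) (\<Union>j\<in>J. A j))"
  then have E: "E \<in> sets pos_reals" by (simp add: pol_block_def)
  show "emeasure (pol_block Q (\<Union>i\<in>I. A i) (\<Union>j\<in>J. A j)) E = emeasure (pol_block P (\<Union>i\<in>I. A i) (\<Union>j\<in>J. A j)) E"
    unfolding sum[OF P E] sum[OF Q E] using agree by (intro sum.cong) auto
qed (simp add: pol_block_def)

section \<open>Density\<close>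

context interval_coordinate
begin

definition block :: "real \<Rightarrow> nat \<Rightarrow> 'a set" where
  "block \<delta> i = f -` cell \<delta> i \<inter> space M"

lemma block_sets: "block \<delta> i \<in> sets M"
  unfolding block_def by (rule measurable_sets[OF f_measurable cell_borel])

lemma block_disjoint: "0 \<le> \<delta> \<Longrightarrow> disjoint_family (block \<delta>)"
  using cell_partition(2)[of \<delta>] unfolding disjoint_family_on_def block_def by blast

lemma UN_block: "(\<Union>i\<in>J. block \<delta> i) = f -` (\<Union>i\<in>J. cell \<delta> i) \<inter> space M"
  by (auto simp: block_def)

lemma block_cover:
  assumes "0 < n"
  shows "(\<Union>i<n. block (L / real n) i) = space M"
  using f_range cell_partition(1)[of "L / real n" n] assms L_pos unfolding UN_block by auto

lemma emeasure_block:
  assumes "i < n"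
  shows "emeasure M (block (L / real n) i) = ennreal (L / real n)"
proof -
  have "cell (L / real n) i \<subseteq> {0..<L}"
    using cell_partition(1)[of "L / real n" n] assms L_pos by (auto simp: less_imp_le)
  then have "emeasure M (block (L / real n) i) = emeasure lborel (cell (L / real n) i)"
    unfolding block_def by (intro f_law cell_borel)
  also have "emeasure lborel (cell d i) = ennreal d" if "0 \<le> d" for d
    unfolding cell_def using that by (subst emeasure_lborel_Ico) (simp_all add: algebra_simps)
  then have "emeasure lborel (cell (L / real n) i) = ennreal (L / real n)" using L_pos by simp
  finally show ?thesis .
qed

text \<open>The coordinate is injective on a set of full measure, so up to a null set every measurable set is
the preimage of a Lebesgue set, and the approximation by cells pulls back.\<close>

lemma approx_by_blocks:
  assumes S: "S \<in> sets M" and \<epsilon>: "0 < \<epsilon>"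
  shows "\<forall>\<^sub>F n in sequentially. \<exists>J\<subseteq>{..<n}. measure M (sym_diff S (\<Union>i\<in>J. block (L / real n) i)) < \<epsilon>"
proof -
  let ?B = "f ` (S \<inter> X)"
  have B: "?B \<in> sets lebesgue" "?B \<subseteq> {0..<L}"
    using S X_sets f_range X_space by (auto intro!: f_image)
  show ?thesis
    using lebesgue_set_approx_by_cells[OF B L_pos \<epsilon>] eventually_gt_at_top[of 0]
  proof eventually_elim
    fix n :: nat assume n: "0 < n"
    let ?\<delta> = "L / real n"
    assume "\<exists>J\<subseteq>{..<n}. emeasure lebesgue (sym_diff ?B (\<Union>i\<in>J. cell ?\<delta> i)) < ennreal \<epsilon>"
    then obtain J where J: "J \<subseteq> {..<n}" "emeasure lebesgue (sym_diff ?B (\<Union>i\<in>J. cell ?\<delta> i)) < ennreal \<epsilon>" by blast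
    let ?U = "\<Union>i\<in>J. cell ?\<delta> i" and ?V = "\<Union>i\<in>J. block ?\<delta> i"
    have finJ: "finite J" using J(1) finite_subset by blast
    have U: "?U \<in> sets borel" "?U \<subseteq> {0..<L}"
      using finJ J(1) cell_partition(1)[of ?\<delta> n] L_pos n by (auto simp: less_imp_le intro: sets.finite_UN)
    have V: "?V \<in> sets M" using finJ block_sets by (intro sets.finite_UN)
    have D: "sym_diff ?B ?U \<in> sets lebesgue" "sym_diff ?B ?U \<subseteq> {0..<L}"
      using B U by (auto intro!: sets.Un sets.Diff)
    have "emeasure M (sym_diff S ?V) = emeasure (completion M) (sym_diff S ?V)" using S V by simp
    also have "\<dots> = emeasure (completion M) (f -` sym_diff ?B ?U \<inter> space M)"
    proof (rule emeasure_eq_AE)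
      show "AE x in completion M. (x \<in> sym_diff S ?V) = (x \<in> f -` sym_diff ?B ?U \<inter> space M)"
        using AE_not_in[OF X_compl_null] AE_space
      proof eventually_elim
        fix x assume "x \<notin> space M - X" "x \<in> space (completion M)"
        then have x: "x \<in> X" "x \<in> space M" by auto
        have "f x \<in> ?B \<longleftrightarrow> x \<in> S" using x(1) inj_onD[OF f_inj] by blast
        moreover have "x \<in> ?V \<longleftrightarrow> f x \<in> ?U" using x(2) unfolding UN_block by blast
        ultimately show "(x \<in> sym_diff S ?V) = (x \<in> f -` sym_diff ?B ?U \<inter> space M)" using x(2) by blast
      qed
      show "sym_diff S ?V \<in> sets (completion M)" using S V by simp
      show "f -` sym_diff ?B ?U \<inter> space M \<in> sets (completion M)" by (rule vimage_lebesgue(1)[OF D(1)])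
    qed
    also have "\<dots> = emeasure lebesgue (sym_diff ?B ?U)" by (rule vimage_lebesgue(2)[OF D])
    also have "\<dots> < ennreal \<epsilon>" by (rule J(2))
    finally have "measure M (sym_diff S ?V) < \<epsilon>"
      using \<epsilon> by (simp add: emeasure_eq_measure ennreal_less_iff)
    then show "\<exists>J\<subseteq>{..<n}. measure M (sym_diff S (\<Union>i\<in>J. block ?\<delta> i)) < \<epsilon>" using J(1) by blast
  qed
qed

text \<open>At a fixed level of subdivision no limit is needed: some transformation has exactly the same blocks
as \<open>P\<close>. The marginal conditions defining polymorphisms say precisely that the masses and means of the
blocks of \<open>P\<close> have the row and column sums required to cut the interval into pieces.\<close>

lemma gms_with_prescribed_blocks:
  assumes P: "P \<in> pol M" and n: "0 < n"
  shows "\<exists>g\<in>gms M. \<forall>i<n. \<forall>j<n. pol_block (pol_of_gms M g) (block (L / real n) i) (block (L / real n) j)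
    = pol_block P (block (L / real n) i) (block (L / real n) j)"
proof -
  interpret P: polymorphism M P using finite_measure_axioms P by (intro polymorphism.intro polymorphism_axioms.intro)
  define \<delta> where "\<delta> = L / real n"
  have \<delta>: "0 < \<delta>" "real n * \<delta> = L" using L_pos n by (auto simp: \<delta>_def)
  let ?A = "block \<delta>"
  note A = block_sets[of \<delta>] and Adisj = block_disjoint[OF less_imp_le[OF \<delta>(1)]]
  have cover: "(\<Union>i<n. ?A i) = space M" unfolding \<delta>_def by (rule block_cover[OF n])
  have mA: "emeasure M (?A i) = ennreal \<delta>" if "i < n" for i
    using emeasure_block[OF that] by (simp add: \<delta>_def)
  have ind: "(\<Sum>i<n. indicator (?A i) a) = (1 :: ennreal)" if "a \<in> space M" for a
  proof -
    have "(\<Sum>i<n. indicator (?A i) a) = (indicator (\<Union>i<n. ?A i) a :: ennreal)"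
      using Adisj by (intro indicator_UN_disjoint[symmetric]) (auto simp: disjoint_family_on_def)
    then show ?thesis using that cover by simp
  qed
  let ?p = "\<lambda>i j. pol_block P (?A i) (?A j)"
  define c where "c i j = enn2real (emeasure (?p i j) (space (?p i j)))" for i j
  define e where "e i j = enn2real (\<integral>\<^sup>+t. ennreal t \<partial>?p i j)" for i j
  have nab: "?p i j \<in> M_nabla" for i j by (rule P.pol_block_in_M_nabla[OF A A])
  have mass: "emeasure (?p i j) (space (?p i j)) = ennreal (c i j)" for i j
    using nab[of i j] by (simp add: c_def M_nabla_def less_top[symmetric])
  have mean: "(\<integral>\<^sup>+t. ennreal t \<partial>?p i j) = ennreal (e i j)" for i j
    using nab[of i j] by (simp add: e_def M_nabla_def less_top[symmetric])
  have c_nn: "0 \<le> c i j" and e_nn: "0 \<le> e i j" for i j by (simp_all add: c_def e_def)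
  note [measurable] = A
  have c_sum: "(\<Sum>j<n. c i j) = \<delta>" if i: "i < n" for i
  proof -
    have "ennreal (\<Sum>j<n. c i j) = (\<Sum>j<n. emeasure (?p i j) (space (?p i j)))"
      unfolding mass by (rule sum_ennreal[symmetric]) (rule c_nn)
    also have "\<dots> = (\<Sum>j<n. \<integral>\<^sup>+x. indicator (?A i) (fst x) * indicator (?A j) (fst (snd x)) \<partial>P)"
    proof (rule sum.cong[OF refl])
      fix j
      have "emeasure (?p i j) (space (?p i j)) = (\<integral>\<^sup>+t. 1 \<partial>?p i j)" by simp
      also have "\<dots> = (\<integral>\<^sup>+x. indicator (?A i) (fst x) * indicator (?A j) (fst (snd x)) \<partial>P)"
        by (subst P.nn_integral_pol_block[OF A A]) simp_all
      finally show "emeasure (?p i j) (space (?p i j)) = (\<integral>\<^sup>+x. indicator (?A i) (fst x) * indicator (?A j) (fst (snd x)) \<partial>P)" .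
    qed
    also have "\<dots> = (\<integral>\<^sup>+x. (\<Sum>j<n. indicator (?A i) (fst x) * indicator (?A j) (fst (snd x))) \<partial>P)"
      by (rule nn_integral_sum[symmetric]) measurable
    also have "\<dots> = (\<integral>\<^sup>+x. indicator (?A i) (fst x) \<partial>P)"
      by (intro nn_integral_cong) (auto simp: sum_distrib_left[symmetric] ind P.space_Q)
    also have "\<dots> = ennreal \<delta>" by (simp add: P.nn_integral_first A mA[OF i])
    finally show ?thesis using c_nn \<delta>(1) by (simp add: sum_nonneg)
  qed
  have e_sum: "(\<Sum>i<n. e i j) = \<delta>" if j: "j < n" for j
  proof -
    have "ennreal (\<Sum>i<n. e i j) = (\<Sum>i<n. \<integral>\<^sup>+t. ennreal t \<partial>?p i j)"
      unfolding mean by (rule sum_ennreal[symmetric]) (rule e_nn)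
    also have "\<dots> = (\<Sum>i<n. \<integral>\<^sup>+x. ennreal (snd (snd x)) * (indicator (?A i) (fst x) * indicator (?A j) (fst (snd x))) \<partial>P)"
      by (intro sum.cong refl P.nn_integral_pol_block A pos_reals_ennreal_measurable)
    also have "\<dots> = (\<integral>\<^sup>+x. (\<Sum>i<n. ennreal (snd (snd x)) * (indicator (?A i) (fst x) * indicator (?A j) (fst (snd x)))) \<partial>P)"
      by (rule nn_integral_sum[symmetric]) measurable
    also have "\<dots> = (\<integral>\<^sup>+x. ennreal (snd (snd x)) * indicator (?A j) (fst (snd x)) \<partial>P)"
      by (intro nn_integral_cong) (auto simp: sum_distrib_left[symmetric] sum_distrib_right[symmetric] ind P.space_Q)
    also have "\<dots> = ennreal \<delta>" by (simp add: P.nn_integral_second A mA[OF j])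
    finally show ?thesis using e_nn \<delta>(1) by (simp add: sum_nonneg)
  qed
  obtain h D :: "real \<Rightarrow> real" where h: "h \<in> borel_measurable borel" and D: "D \<in> borel_measurable borel"
    and Dpos: "\<And>x. 0 < D x" and hbij: "bij_betw h {0..<real n * \<delta>} {0..<real n * \<delta>}"
    and him: "\<And>E. E \<in> sets borel \<Longrightarrow> E \<subseteq> {0..<real n * \<delta>} \<Longrightarrow> h ` E \<in> sets borel"
    and hem: "\<And>E. E \<in> sets borel \<Longrightarrow> E \<subseteq> {0..<real n * \<delta>} \<Longrightarrow> emeasure lborel (h ` E) = (\<integral>\<^sup>+x\<in>E. ennreal (D x) \<partial>lborel)"
    and law: "\<And>i j E. i < n \<Longrightarrow> j < n \<Longrightarrow> E \<in> sets borel \<Longrightarrow> E \<subseteq> {0<..} \<Longrightarrow>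
       emeasure lborel {x\<in>cell \<delta> i. h x \<in> cell \<delta> j \<and> D x \<in> E} = emeasure (?p i j) E"
    by (rule interval_map_with_blocks[of ?p n c e \<delta>])
       (use P.sets_pol_block mass mean c_nn c_sum e_nn e_sum \<delta>(1) in \<open>simp_all add: less_imp_le\<close>)
  have "coordinate_automorphism M f L X h D"
    by (intro coordinate_automorphism.intro interval_coordinate_axioms interval_automorphism.intro h D Dpos)
       (use hbij him hem \<delta>(2) in auto)
  then interpret T: coordinate_automorphism M f L X h D .
  let ?g = T.transport and ?C = "completion M"
  note g = T.transport_in_gms
  have "pol_block (pol_of_gms M ?g) (?A i) (?A j) = ?p i j" if ij: "i < n" "j < n" for i j
  proof (rule measure_eqI)
    interpret G: polymorphism M "pol_of_gms M ?g"
      using finite_measure_axioms pol_of_gms_in_pol[OF finite_measure_axioms g] by (intro polymorphism.intro polymorphism_axioms.intro)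
    fix E assume "E \<in> sets (pol_block (pol_of_gms M ?g) (?A i) (?A j))"
    then have E: "E \<in> sets pos_reals" by (simp add: pol_block_def)
    then have Eb: "E \<in> sets borel" "E \<subseteq> {0<..}" by (simp_all add: sets_pos_reals)
    let ?S = "{a\<in>space M. a \<in> ?A i \<and> ?g a \<in> ?A j \<and> gms_deriv M ?g a \<in> E}"
    let ?B = "{x\<in>cell \<delta> i. h x \<in> cell \<delta> j \<and> D x \<in> E}"
    have Beq: "?B = cell \<delta> i \<inter> (h -` cell \<delta> j \<inter> D -` E)" by auto
    have B: "?B \<in> sets borel" unfolding Beq
      using measurable_sets[OF h cell_borel] measurable_sets[OF D Eb(1)] by (intro sets.Int cell_borel) simp_all
    have "cell \<delta> i \<subseteq> {0..<L}"
      using cell_partition(1)[of \<delta> n] ij \<delta> by auto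
    then have BL: "?B \<subseteq> {0..<L}" by blast
    have "emeasure (pol_block (pol_of_gms M ?g) (?A i) (?A j)) E = emeasure ?C ?S"
      unfolding G.emeasure_pol_block[OF A A E] by (rule pol_of_gms_rectangle[OF finite_measure_axioms g A A E])
    also have "\<dots> = emeasure ?C (f -` ?B \<inter> space M)"
    proof (rule emeasure_eq_AE)
      have "AE a in M. (a \<in> ?S) = (a \<in> f -` ?B \<inter> space M)"
        using T.transport_coordinate T.transport_deriv AE_space
      proof eventually_elim
        fix a assume a: "f (?g a) = h (f a)" "gms_deriv M ?g a = D (f a)" "a \<in> space M"
        have "?g a \<in> space M" using measurable_space[OF gmsD(1)[OF g], of a] a(3) by simp
        then show "(a \<in> ?S) = (a \<in> f -` ?B \<inter> space M)" using a by (simp add: block_def)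
      qed
      then show "AE a in ?C. (a \<in> ?S) = (a \<in> f -` ?B \<inter> space M)" by (rule AE_completion)
      show "f -` ?B \<inter> space M \<in> sets ?C" using measurable_sets[OF f_measurable B] by (rule sets_completionI_sets)
      have "(\<lambda>a. (a, ?g a, gms_deriv M ?g a)) -` (?A i \<times> ?A j \<times> E) \<inter> space ?C \<in> sets ?C"
        by (rule measurable_sets[OF pol_of_gms_map_measurable[OF finite_measure_axioms g] pair_measureI[OF A pair_measureI[OF A E]]])
      also have "(\<lambda>a. (a, ?g a, gms_deriv M ?g a)) -` (?A i \<times> ?A j \<times> E) \<inter> space ?C = ?S" by auto
      finally show "?S \<in> sets ?C" .
    qed
    also have "\<dots> = emeasure M (f -` ?B \<inter> space M)" using measurable_sets[OF f_measurable B] by simp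
    also have "\<dots> = emeasure lborel ?B" by (rule f_law[OF B BL])
    also have "\<dots> = emeasure (?p i j) E" by (rule law[OF ij Eb])
    finally show "emeasure (pol_block (pol_of_gms M ?g) (?A i) (?A j)) E = emeasure (?p i j) E" .
  qed (simp add: pol_block_def)
  then show ?thesis using g unfolding \<delta>_def by blast
qed

lemma gms_dense_in_pol: "dense_in_pol M (pol_of_gms M ` gms M)"
  unfolding dense_in_pol_def
proof (intro conjI ballI)
  show "pol_of_gms M ` gms M \<subseteq> pol M"
    using pol_of_gms_in_pol[OF finite_measure_axioms] by blast
  fix P assume P: "P \<in> pol M"
  let ?\<delta> = "\<lambda>n. L / real (Suc n)"
  have "\<exists>g\<in>gms M. \<forall>i<Suc n. \<forall>j<Suc n. pol_block (pol_of_gms M g) (block (?\<delta> n) i) (block (?\<delta> n) j)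
    = pol_block P (block (?\<delta> n) i) (block (?\<delta> n) j)" for n
    by (rule gms_with_prescribed_blocks[OF P]) simp
  then obtain g where g: "\<And>n. g n \<in> gms M"
    and eq: "\<And>n i j. i < Suc n \<Longrightarrow> j < Suc n \<Longrightarrow> pol_block (pol_of_gms M (g n)) (block (?\<delta> n) i) (block (?\<delta> n) j)
    = pol_block P (block (?\<delta> n) i) (block (?\<delta> n) j)"
    by metis
  define \<A> where "\<A> n = (\<lambda>J. \<Union>i\<in>J. block (?\<delta> n) i) ` Pow {..<Suc n}" for n
  have gpol: "pol_of_gms M (g n) \<in> pol M" for n by (rule pol_of_gms_in_pol[OF finite_measure_axioms g])
  have "pol_conv M (\<lambda>n. pol_of_gms M (g n)) P"
  proof (rule pol_conv_by_block_agreement[OF finite_measure_axioms P gpol, of \<A>])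
    fix n
    show "\<A> n \<subseteq> sets M"
      unfolding \<A>_def by (auto intro!: sets.finite_UN block_sets intro: finite_subset)
    show "space M \<in> \<A> n"
      unfolding \<A>_def using block_cover[of "Suc n"] by (intro image_eqI[of _ _ "{..<Suc n}"]) auto
    fix S T assume "S \<in> \<A> n" "T \<in> \<A> n"
    then obtain I J where IJ: "I \<subseteq> {..<Suc n}" "J \<subseteq> {..<Suc n}"
      and ST: "S = (\<Union>i\<in>I. block (?\<delta> n) i)" "T = (\<Union>j\<in>J. block (?\<delta> n) j)"
      unfolding \<A>_def by blast
    show "pol_block (pol_of_gms M (g n)) S T = pol_block P S T"
      unfolding ST
    proof (rule pol_block_eq_on_unions[OF finite_measure_axioms P gpol block_sets])
      show "disjoint_family (block (?\<delta> n))" using L_pos by (intro block_disjoint) simp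
      show "finite I" "finite J" using IJ by (auto intro: finite_subset)
      show "pol_block (pol_of_gms M (g n)) (block (?\<delta> n) i) (block (?\<delta> n) j) = pol_block P (block (?\<delta> n) i) (block (?\<delta> n) j)"
        if "i \<in> I" "j \<in> J" for i j using that IJ by (intro eq) auto
    qed
  next
    fix S and \<epsilon> :: real assume "S \<in> sets M" "0 < \<epsilon>"
    from approx_by_blocks[OF this]
    have "\<forall>\<^sub>F n in sequentially. \<exists>J\<subseteq>{..<Suc n}. measure M (sym_diff S (\<Union>i\<in>J. block (?\<delta> n) i)) < \<epsilon>"
      by (rule eventually_sequentially_Suc[THEN iffD2])
    then show "\<forall>\<^sub>F n in sequentially. \<exists>S'\<in>\<A> n. measure M (sym_diff S S') < \<epsilon>"
      by eventually_elim (auto simp: \<A>_def)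
  qed
  then show "\<exists>Ps. (\<forall>n. Ps n \<in> pol_of_gms M ` gms M) \<and> pol_conv M Ps P"
    using g by (intro exI[of _ "\<lambda>n. pol_of_gms M (g n)"]) blast
qed

end

theorem theorem5p13:
  fixes M :: "'a measure"
  assumes "lebesgue_space M" and "continuous_measure M"
  shows "dense_in_pol M (pol_of_gms M ` gms M)"
proof -
  obtain f L X where "interval_coordinate M f L X"
    using lebesgue_space_coordinate[OF assms] .
  then show ?thesis by (rule interval_coordinate.gms_dense_in_pol)
qed

end
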